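(* For every integer $k\ge1$, there is no non-constant morphism of curves from $D_{k+1}$ to $D_k$.
   Context: For $k\ge1$, $D_k$ denotes the smooth projective (absolutely irreducible) curve over $\mathbb{F}_2$ birational to the affine curve $y^2+y=x^{2^k+1}+x^{-1}$; morphisms are morphisms of curves over $\mathbb{F}_2$. *)

theory Defs
  imports
    "HOL-Library.Function_Algebras"
    "HOL-Library.Poly_Mapping"
    "HOL-Library.Z2"
    "HOL-Algebra.Algebraic_Closure_Type"
begin

text \<open>
  Varieties are treated classically: a variety over \<open>F\<^sub>2\<close> is identified with its set of
  points over the algebraic closure of \<open>F\<^sub>2\<close>, and being ``over \<open>F\<^sub>2\<close>'' means that
  all defining polynomials have coefficients in the prime field. As \<open>F\<^sub>2\<close> is perfect, a
  closed set given by equations over \<open>F\<^sub>2\<close> has its vanishing ideal generated over \<open>F\<^sub>2\<close>.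
\<close>

type_synonym F2bar = "bit alg_closure"

definition F2 :: "F2bar set" where
  "F2 = range to_ac"


section \<open>Multivariate polynomials\<close>

text \<open>A monomial maps each variable index to its exponent.\<close>

type_synonym 'a mpoly = "(nat \<Rightarrow>\<^sub>0 nat) \<Rightarrow>\<^sub>0 'a"

definition mpoly_eval :: "'a::comm_ring_1 mpoly \<Rightarrow> (nat \<Rightarrow> 'a) \<Rightarrow> 'a" where
  "mpoly_eval F v =
     (\<Sum>m\<in>Poly_Mapping.keys F. Poly_Mapping.lookup F m *
       (\<Prod>i\<in>Poly_Mapping.keys m. v i ^ Poly_Mapping.lookup m i))"

text \<open>The gradient (formal partial derivatives) of \<open>F\<close> at \<open>v\<close>.\<close>

definition mpoly_grad :: "'a::comm_ring_1 mpoly \<Rightarrow> (nat \<Rightarrow> 'a) \<Rightarrow> (nat \<Rightarrow> 'a)" where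
  "mpoly_grad F v = (\<lambda>i. \<Sum>m\<in>Poly_Mapping.keys F.
     of_nat (Poly_Mapping.lookup m i) * Poly_Mapping.lookup F m *
       (\<Prod>j\<in>Poly_Mapping.keys m. v j ^ (Poly_Mapping.lookup m j - (if j = i then 1 else 0))))"

text \<open>Homogeneous polynomials of degree \<open>d\<close> in the variables \<open>0, \<dots>, n\<close> with coefficients
  in \<open>R\<close> (the zero polynomial is included, provided \<open>0 \<in> R\<close>).\<close>

definition forms :: "'a::comm_ring_1 set \<Rightarrow> nat \<Rightarrow> nat \<Rightarrow> 'a mpoly set" where
  "forms R n d = {F. range (Poly_Mapping.lookup F) \<subseteq> R \<and>
     (\<forall>m\<in>Poly_Mapping.keys F. Poly_Mapping.keys m \<subseteq> {..n} \<and>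
        (\<Sum>i\<in>Poly_Mapping.keys m. Poly_Mapping.lookup m i) = d)}"


section \<open>Projective space and its Zariski topology\<close>

text \<open>A point of projective \<open>n\<close>-space is the set of all its homogeneous coordinate vectors;
  coordinate vectors are functions on \<open>nat\<close> that vanish beyond index \<open>n\<close>.\<close>

type_synonym point = "(nat \<Rightarrow> F2bar) set"

definition proj_pt :: "(nat \<Rightarrow> F2bar) \<Rightarrow> point" where
  "proj_pt v = {\<lambda>i. c * v i | c. c \<noteq> 0}"

definition proj_space :: "nat \<Rightarrow> point set" where
  "proj_space n = {proj_pt v | v. (\<exists>i. v i \<noteq> 0) \<and> (\<forall>i>n. v i = 0)}"

definition vanishes_at :: "F2bar mpoly \<Rightarrow> point \<Rightarrow> bool" where
  "vanishes_at F P \<longleftrightarrow> (\<forall>v\<in>P. mpoly_eval F v = 0)"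

definition zero_locus :: "nat \<Rightarrow> F2bar mpoly set \<Rightarrow> point set" where
  "zero_locus n S = {P \<in> proj_space n. \<forall>F\<in>S. vanishes_at F P}"

definition zariski_closed :: "F2bar set \<Rightarrow> nat \<Rightarrow> point set \<Rightarrow> bool" where
  "zariski_closed R n Z \<longleftrightarrow> (\<exists>S. S \<subseteq> (\<Union>d. forms R n d) \<and> Z = zero_locus n S)"

definition rel_open :: "F2bar set \<Rightarrow> nat \<Rightarrow> point set \<Rightarrow> point set \<Rightarrow> bool" where
  "rel_open R n V U \<longleftrightarrow> (\<exists>Z. zariski_closed R n Z \<and> U = V - Z)"

text \<open>Irreducibility refers to closed sets over the algebraic closure, i.e. it is absolute
  irreducibility.\<close>

definition abs_irreducible :: "nat \<Rightarrow> point set \<Rightarrow> bool" where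
  "abs_irreducible n V \<longleftrightarrow> V \<noteq> {} \<and>
     (\<forall>A B. zariski_closed UNIV n A \<and> zariski_closed UNIV n B \<and> V \<subseteq> A \<union> B \<longrightarrow> V \<subseteq> A \<or> V \<subseteq> B)"

definition irreducible_chain :: "nat \<Rightarrow> point set \<Rightarrow> nat \<Rightarrow> (nat \<Rightarrow> point set) \<Rightarrow> bool" where
  "irreducible_chain n V d Z \<longleftrightarrow>
     (\<forall>i\<le>d. zariski_closed UNIV n (Z i) \<and> abs_irreducible n (Z i) \<and> Z i \<subseteq> V) \<and>
     (\<forall>i<d. Z i \<subset> Z (Suc i))"

text \<open>Krull dimension of a closed set. Chains can be truncated, so it suffices to exclude
  those of length \<open>d + 1\<close>.\<close>

definition has_dimension :: "nat \<Rightarrow> point set \<Rightarrow> nat \<Rightarrow> bool" where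
  "has_dimension n V d \<longleftrightarrow>
     (\<exists>Z. irreducible_chain n V d Z) \<and> \<not> (\<exists>Z. irreducible_chain n V (Suc d) Z)"


section \<open>Smooth projective curves\<close>

text \<open>The homogeneous elements of the vanishing ideal over the algebraic closure.\<close>

definition vanishing_forms :: "nat \<Rightarrow> point set \<Rightarrow> F2bar mpoly set" where
  "vanishing_forms n V = {F \<in> (\<Union>d. forms UNIV n d). \<forall>P\<in>V. vanishes_at F P}"

text \<open>Jacobian criterion: in homogeneous coordinates, a \<open>d\<close>-dimensional \<open>V\<close> in
  \<open>n\<close>-space is smooth at a point iff the gradients of the vanishing forms there have
  rank \<open>n - d\<close>.\<close>

definition smooth_of_dim :: "nat \<Rightarrow> point set \<Rightarrow> nat \<Rightarrow> bool" where
  "smooth_of_dim n V d \<longleftrightarrow> (\<forall>P\<in>V. \<forall>v\<in>P.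
     vector_space.dim (\<lambda>c w i. c * w i) {mpoly_grad F v | F. F \<in> vanishing_forms n V} + d = n)"

lemma vector_space_coordinate_vectors:
  "vector_space (\<lambda>c (w :: nat \<Rightarrow> 'a::field) i. c * w i)"
  by unfold_locales (auto simp: algebra_simps fun_eq_iff)

definition smooth_projective_curve :: "nat \<Rightarrow> point set \<Rightarrow> bool" where
  "smooth_projective_curve n V \<longleftrightarrow>
     zariski_closed F2 n V \<and> abs_irreducible n V \<and> has_dimension n V 1 \<and> smooth_of_dim n V 1"


section \<open>Morphisms and birational equivalence over the prime field\<close>

text \<open>A morphism over \<open>F\<^sub>2\<close> between quasi-projective sets is a map that is, locally in the
  Zariski topology, given by homogeneous polynomials over \<open>F\<^sub>2\<close> of the same degree without
  common zeros.\<close>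

definition morphism_over_F2 ::
  "nat \<Rightarrow> point set \<Rightarrow> nat \<Rightarrow> point set \<Rightarrow> (point \<Rightarrow> point) \<Rightarrow> bool" where
  "morphism_over_F2 n V m W f \<longleftrightarrow> f ` V \<subseteq> W \<and>
     (\<forall>P\<in>V. \<exists>U d G. rel_open F2 n V U \<and> P \<in> U \<and> (\<forall>i\<le>m. G i \<in> forms F2 n d) \<and>
        (\<forall>Q\<in>U. \<forall>v\<in>Q. (\<exists>i\<le>m. mpoly_eval (G i) v \<noteq> 0) \<and>
           f Q = proj_pt (\<lambda>i. if i \<le> m then mpoly_eval (G i) v else 0)))"

definition nonconstant_on :: "point set \<Rightarrow> (point \<Rightarrow> point) \<Rightarrow> bool" where
  "nonconstant_on V f \<longleftrightarrow> \<not> (\<exists>Q. \<forall>P\<in>V. f P = Q)"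

definition birational_over_F2 :: "nat \<Rightarrow> point set \<Rightarrow> nat \<Rightarrow> point set \<Rightarrow> bool" where
  "birational_over_F2 n V m W \<longleftrightarrow>
     (\<exists>U U' f g. U \<noteq> {} \<and> U' \<noteq> {} \<and> rel_open F2 n V U \<and> rel_open F2 m W U' \<and>
        morphism_over_F2 n U m U' f \<and> morphism_over_F2 m U' n U g \<and>
        (\<forall>P\<in>U. g (f P) = P) \<and> (\<forall>Q\<in>U'. f (g Q) = Q))"


section \<open>The curves in question\<close>

text \<open>The affine curve, as a subset of the projective plane via \<open>(x, y) \<mapsto> [1 : x : y]\<close>.\<close>

definition D_affine :: "nat \<Rightarrow> point set" where
  "D_affine k = {proj_pt (\<lambda>i. if i = 0 then 1 else if i = 1 then x else if i = 2 then y else 0)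
     | x y. x \<noteq> 0 \<and> y ^ 2 + y = x ^ (2 ^ k + 1) + inverse x}"

text \<open>\<open>V\<close>, embedded in projective \<open>n\<close>-space, is the smooth projective curve birational to
  the affine one. It is unique up to isomorphism, so that statements about it are phrased for
  all such \<open>V\<close>.\<close>

definition is_D_curve :: "nat \<Rightarrow> nat \<Rightarrow> point set \<Rightarrow> bool" where
  "is_D_curve k n V \<longleftrightarrow> smooth_projective_curve n V \<and> birational_over_F2 2 (D_affine k) n V"

end

theory Submission
  imports Defs "HOL-Computational_Algebra.Formal_Laurent_Series"
begin

text \<open>
  Let \<open>q = 2\<^bsup>k\<^esup>\<close> and let \<open>F\<close> be the function field of \<open>D\<^bsub>k+1\<^esub>\<close> over the algebraic closure \<open>K\<close>
  of the prime field. As \<open>W\<close> has dimension one, a nonconstant morphism is dominant, hence yields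
  \<open>u, v \<in> F\<close> with \<open>v\<^sup>2 + v = u\<^bsup>q+1\<^esup> + u\<^bsup>-1\<^esup>\<close> and \<open>u\<close> not constant. The derivation
  \<open>\<delta> = x d/dx\<close> of \<open>F\<close> is examined at all places, a place being a point of the curve with coordinates
  in \<open>K((t))\<close>. The equation forces the differentials \<open>du\<close> and \<open>du/u\<close> to be holomorphic, and the
  holomorphic differentials of \<open>D\<^bsub>k+1\<^esub>\<close> are of the form \<open>p(x) dx/x\<close> with a polynomial \<open>p\<close>, so that
  \<open>\<delta>u\<close> and \<open>\<delta>u/u\<close> are polynomials in \<open>x\<close>. If \<open>\<delta>u \<noteq> 0\<close>, their quotient \<open>u\<close> lies in \<open>K(x)\<close>;
  in characteristic two the logarithmic derivative \<open>s = \<delta>u/u\<close> satisfies \<open>\<delta>s + s\<^sup>2 = s\<close>, whence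
  \<open>s = 1\<close> and \<open>u\<close> is a polynomial of odd degree, which contradicts the valuation of \<open>v\<close> at infinity.
  If \<open>\<delta>u = 0\<close>, then \<open>u\<close> and \<open>v\<close> can be replaced by a smaller solution because \<open>u\<close> is a square in \<open>F\<close>.
\<close>

section \<open>Characteristic two\<close>

text \<open>Genus counting alone does not suffice: 2g - 2 equals 2q for the source and q for the
  target, so a separable map of degree two would be conceivable. Hence the study of differentials.
  The genus q + 1 of the source is exhausted by x^i dx/x with 0 \<le> i \<le> q, whereas y dx/x has
  a simple pole at infinity; this margin of one keeps y out of all holomorphic differentials. On the
  side of the target, dv = (u^q + u^-2) du, and v has only half the pole order of u^(q+1) + u^-1, so
  the large coefficient of du leaves no room for poles of du or du/u.

  Elements of the function field are not built as a type. Polynomials a, b, d over K stand for (a +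
  b y)/d, and they can be evaluated at points over K and over K((t)) alike. The norm to K(x) of a
  nonzero function is nonzero, so the function has finitely many zeros over K and none at the
  places. This is how irreducibility of the affine curve enters, and it lets identities move between
  geometry and places.\<close>

class char2 = comm_ring_1 +
  assumes one_add_one_eq_0: "1 + 1 = 0"
begin

lemma add_self [simp]: "x + x = 0"
  using distrib_left[of x 1 1] unfolding one_add_one_eq_0 by simp

lemma add_self_left [simp]: "x + (x + y) = y"
  by (simp flip: add.assoc)

lemma uminus_eq [simp]: "- x = x"
  by (simp add: minus_unique)

lemma diff_eq_add [simp]: "x - y = x + y"
  using diff_conv_add_uminus[of x y] by simp

lemma add_eq_0_iff_eq: "x + y = 0 \<longleftrightarrow> x = y"
  by (simp add: eq_neg_iff_add_eq_0 [symmetric])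

lemma two_eq_0 [simp]: "2 = 0"
  using one_add_one one_add_one_eq_0 by (simp only:)

lemma power2_add: "(x + y)\<^sup>2 = x\<^sup>2 + y\<^sup>2"
  by (simp add: power2_eq_square algebra_simps)

lemma of_nat_char2: "of_nat n = (if even n then 0 else 1)"
  by (induction n) (auto simp: one_add_one_eq_0)

end

instance bit :: char2
  by standard simp

instance alg_closure :: ("{field,char2}") char2
proof
  have "to_ac (1 + 1 :: 'a) = 0" by (simp only: one_add_one_eq_0 to_ac_0)
  then show "1 + 1 = (0 :: 'a alg_closure)" by (simp only: to_ac_add to_ac_1)
qed

instance poly :: (char2) char2
  by standard (simp add: one_pCons one_add_one_eq_0)

instance fls :: (char2) char2
  by standard (rule fls_eqI, simp only: fls_plus_nth fls_one_nth fls_zero_nth, simp)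

section \<open>Laurent series\<close>

abbreviation val :: "'a::zero fls \<Rightarrow> int"
  where "val \<equiv> fls_subdegree"

abbreviation dt :: "'a::comm_ring_1 fls \<Rightarrow> 'a fls"
  where "dt \<equiv> fls_deriv"

text \<open>\<open>val\<close> is 0 at the zero series, so the bound survives total cancellation
  only for \<open>n \<le> 0\<close>. By the same convention \<open>0 < val f\<close> already
  excludes \<open>f = 0\<close>.\<close>

lemma val_add_ge:
  assumes "n \<le> val f" "n \<le> val g" "n \<le> 0"
  shows "n \<le> val (f + g)"
  using assms fls_plus_subdegree[of f g] by (cases "f + g = 0") auto

lemma val_dt_ge: "dt f \<noteq> 0 \<Longrightarrow> val f - 1 \<le> val (dt f)"
  by (rule fls_subdegree_geI) auto

lemma dt_inverse_char2: "dt (inverse f) = dt f * (inverse f)\<^sup>2"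
  for f :: "'a::{field,char2} fls"
proof (cases "f = 0")
  case False
  then have "dt (f * inverse f) = 0" by simp
  then have "f * dt (inverse f) = dt f * inverse f"
    by (simp add: add_eq_0_iff_eq)
  with False show ?thesis
    by (simp add: field_simps power2_eq_square)
qed simp

lemma dt_square_char2 [simp]: "dt (f\<^sup>2) = 0" for f :: "'a::char2 fls"
  by (simp add: fls_deriv_power)

lemma val_artin_schreier:
  fixes v w :: "'a::field fls"
  assumes "v\<^sup>2 + v = w" "val w < 0"
  shows "val v < 0" "val w = 2 * val v"
proof -
  have nz: "v \<noteq> 0" using assms by auto
  show neg: "val v < 0"
  proof (rule ccontr)
    assume "\<not> ?thesis"
    then have "0 \<le> val (v\<^sup>2 + v)"
      by (intro val_add_ge) (auto simp: fls_subdegree_pow)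
    with assms show False by simp
  qed
  have "val (v\<^sup>2) = 2 * val v" by (simp add: fls_subdegree_pow)
  then show "val w = 2 * val v"
    using fls_subdegree_add_eq1[of "v\<^sup>2" v] assms(1) nz neg by simp
qed

text \<open>Squares have derivative zero and \<open>q\<close> is even, so dv = (u^q + u^-2) du.
  Where \<open>u\<close> has a zero or pole, the order of \<open>v\<close> is half that of the
  dominant term u^-1 or u^(q+1), and dv loses at most one more. Solving for du leaves order at least
  (3/2) val u - 1 at a zero and (q-1)/2 |val u| - 1 at a pole. This suffices because the halving
  makes val u even, so |val u| is at least 2.\<close>

lemma artin_schreier_differentials_regular:
  fixes u v :: "'a::{field,char2} fls"
  assumes q: "even q" "q \<ge> 2" and nz: "u \<noteq> 0"
    and eq: "v\<^sup>2 + v = u ^ (q + 1) + inverse u"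
  shows "0 \<le> val (dt u)" "0 \<le> val (dt u / u)"
proof -
  have "dt v = dt (v\<^sup>2 + v)" by simp
  also have "\<dots> = dt u * (u ^ q + (inverse u)\<^sup>2)"
    unfolding eq using q
    by (simp add: dt_inverse_char2 fls_deriv_power of_nat_char2 algebra_simps del: power_Suc)
  finally have dY: "dt v = dt u * (u ^ q + (inverse u)\<^sup>2)" .
  have "0 \<le> val (dt u) \<and> 0 \<le> val (dt u) - val u" if d: "dt u \<noteq> 0"
  proof -
    consider "val u = 0" | "val u > 0" | "val u < 0" by linarith
    then show ?thesis
    proof cases
      case 1
      then show ?thesis using fls_deriv_subdegree0 by force
    next
      case 2
      have v2: "val (u ^ (q+1)) > 0" using 2 by (simp add: fls_subdegree_pow del: power_Suc)
      have "val (inverse u + u ^ (q + 1)) = val (inverse u)"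
        using 2 v2 nz by (intro fls_subdegree_add_eq1) (simp_all del: power_Suc)
      then have w: "val (u ^ (q + 1) + inverse u) = - val u"
        by (simp add: add.commute del: power_Suc)
      have j: "val v < 0" "- val u = 2 * val v"
        using val_artin_schreier[OF eq] 2 w by (simp_all del: power_Suc)
      have "0 \<le> int q * val u" using 2 by simp
      then have lt: "- (2 * val u) < int q * val u" using 2 by linarith
      have "val ((inverse u)\<^sup>2 + u ^ q) = val ((inverse u)\<^sup>2)"
        using 2 nz lt by (intro fls_subdegree_add_eq1) (simp_all add: fls_subdegree_pow)
      then have m: "val (u ^ q + (inverse u)\<^sup>2) = - 2 * val u"
        by (simp add: add.commute fls_subdegree_pow)
      then have "u ^ q + (inverse u)\<^sup>2 \<noteq> 0" using 2 by auto
      then have "dt v \<noteq> 0" "val (dt v) = val (dt u) - 2 * val u"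
        using dY m d by auto
      with val_dt_ge[of v] j show ?thesis by linarith
    next
      case 3
      have "val (u ^ (q+1)) = (int q + 1) * val u" by (simp only: fls_subdegree_pow) simp
      moreover have "(int q + 1) * val u < - val u"
        using 3 q by (smt (verit) mult_pos_neg distrib_right of_nat_0_le_iff mult_minus_left mult_cancel_right1 mult_le_0_iff nat_less_real_le of_nat_mono of_nat_numeral mult_right_mono_neg)
      ultimately have "val (u ^ (q+1) + inverse u) = (int q + 1) * val u"
        using 3 nz fls_subdegree_add_eq1[of "u ^ (q+1)" "inverse u"] by (simp del: power_Suc)
      moreover have "(int q + 1) * val u < 0" using 3 by (simp add: mult_pos_neg)
      ultimately have j: "(int q + 1) * val u = 2 * val v"
        using val_artin_schreier[OF eq] by (simp del: power_Suc)
      have "even ((int q + 1) * val u)" using j by simp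
      with q have "even (val u)" by simp
      with 3 have le: "val u \<le> -2" by presburger
      have "val (u ^ q) = int q * val u" by (simp add: fls_subdegree_pow)
      moreover have "int q * val u < 0" using 3 q by (simp add: mult_pos_neg)
      ultimately have m: "val (u ^ q + (inverse u)\<^sup>2) = int q * val u"
        using 3 nz fls_subdegree_add_eq1[of "u ^ q" "(inverse u)\<^sup>2"]
        by (simp add: fls_subdegree_pow)
      then have "u ^ q + (inverse u)\<^sup>2 \<noteq> 0" using \<open>int q * val u < 0\<close> by auto
      then have y: "dt v \<noteq> 0" "val (dt v) = val (dt u) + int q * val u"
        using dY m d by auto
      have "(int q - 1) * val u \<le> 1 * (-2)"
        using le q mult_mono[of 1 "int q - 1" 2 "- val u"] by (simp add: algebra_simps)
      with val_dt_ge[OF y(1)] j y(2) le show ?thesis by (simp add: algebra_simps)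
    qed
  qed
  then show "0 \<le> val (dt u)" "0 \<le> val (dt u / u)"
    using nz by (cases "dt u = 0"; simp add: divide_inverse)+
qed

section \<open>Polynomials evaluated in an extension field\<close>

text \<open>The same polynomials are evaluated at points over K, with \<open>e\<close> the identity,
  and at points over K((t)), with \<open>e = fls_const\<close>.\<close>

locale field_embedding =
  fixes e :: "'k::{field,char2} \<Rightarrow> 'l::{field,char2}"
  assumes e_add: "e (a + b) = e a + e b"
    and e_mult: "e (a * b) = e a * e b"
    and e_1: "e 1 = 1"
begin

lemma e_0: "e 0 = 0"
  using e_add[of 0 0] by simp

definition ev :: "'k poly \<Rightarrow> 'l \<Rightarrow> 'l"
  where "ev p x = poly (map_poly e p) x"

lemma ev_0 [simp]: "ev 0 x = 0"
  by (simp add: ev_def)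

lemma ev_pCons [simp]: "ev (pCons a p) x = e a + x * ev p x"
  by (simp add: ev_def map_poly_pCons e_0)

lemma ev_1 [simp]: "ev 1 x = 1"
  by (simp add: one_pCons e_1)

lemma ev_add [simp]: "ev (p + r) x = ev p x + ev r x"
proof (induction p arbitrary: r)
  case (pCons a p)
  show ?case
    by (cases r) (simp add: pCons.IH e_add distrib_left add.assoc add.left_commute)
qed simp

lemma ev_smult [simp]: "ev (smult a p) x = e a * ev p x"
  by (induction p) (simp_all add: e_mult algebra_simps)

lemma ev_mult [simp]: "ev (p * r) x = ev p x * ev r x"
  by (induction p) (simp_all add: e_0 algebra_simps)

lemma ev_power [simp]: "ev (p ^ n) x = ev p x ^ n"
  by (induction n) simp_all

end

interpretation laurent: field_embedding fls_const
  by standard (simp_all flip: fls_plus_const fls_const_mult_const)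

interpretation base: field_embedding "\<lambda>a. a"
  by standard auto

lemma base_ev [simp]: "base.ev p x = poly p x"
  by (induction p) simp_all

section \<open>Functions on the curve \<open>y\<^sup>2 + y = x\<^bsup>2q+1\<^esup> + x\<^bsup>-1\<^esup>\<close>\<close>

text \<open>With \<open>q = 2^k\<close> this is the source D_{k+1}; the target D_k then has the
  exponent \<open>q + 1\<close>.\<close>

definition acurve :: "nat \<Rightarrow> ('a::field \<times> 'a) set"
  where "acurve q = {(x, y). x \<noteq> 0 \<and> y\<^sup>2 + y = x ^ (2 * q + 1) + inverse x}"

text \<open>\<open>D\<close> is the set of admissible denominators. Nonzero polynomials on the
  places give the function field; powers of \<open>x\<close> give the coordinate ring, on points
  over K or over K((t)).\<close>

locale curve_functions = field_embedding e for e :: "'k::{field,char2} \<Rightarrow> 'l::{field,char2}" +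
  fixes q :: nat and D :: "'k poly set" and S :: "('l \<times> 'l) set"
  assumes S_subset: "S \<subseteq> acurve q"
    and one_in_D: "1 \<in> D" and x_in_D: "[:0, 1:] \<in> D"
    and mult_in_D: "d \<in> D \<Longrightarrow> d' \<in> D \<Longrightarrow> d * d' \<in> D"
begin

definition fractions :: "('l \<times> 'l \<Rightarrow> 'l) set"
  where "fractions = {g. \<exists>d\<in>D. \<exists>a b. \<forall>(x, y)\<in>S. ev d x * g (x, y) = ev a x + ev b x * y}"

lemma fractionsI:
  assumes "d \<in> D" "\<And>x y. (x, y) \<in> S \<Longrightarrow> ev d x * g (x, y) = ev a x + ev b x * y"
  shows "g \<in> fractions"
  using assms unfolding fractions_def by blast

lemma fractionsE:
  assumes "g \<in> fractions"
  obtains d a b where "d \<in> D" "\<And>x y. (x, y) \<in> S \<Longrightarrow> ev d x * g (x, y) = ev a x + ev b x * y"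
  using assms unfolding fractions_def by blast

lemma fractions_const: "(\<lambda>_. e c) \<in> fractions"
  by (rule fractionsI[of 1 _ "[:c:]" 0]) (simp_all add: one_in_D)

lemma fractions_fst: "fst \<in> fractions"
  by (rule fractionsI[of 1 _ "[:0,1:]" 0]) (simp_all add: one_in_D e_0 e_1)

lemma fractions_snd: "snd \<in> fractions"
  by (rule fractionsI[of 1 _ 0 1]) (simp_all add: one_in_D)

lemma fractions_add:
  assumes "g \<in> fractions" "h \<in> fractions"
  shows "(\<lambda>P. g P + h P) \<in> fractions"
proof -
  obtain d a b where "d \<in> D"
    and g: "\<And>x y. (x, y) \<in> S \<Longrightarrow> ev d x * g (x, y) = ev a x + ev b x * y"
    using assms(1) by (rule fractionsE) blast
  obtain d' a' b' where "d' \<in> D"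
    and h: "\<And>x y. (x, y) \<in> S \<Longrightarrow> ev d' x * h (x, y) = ev a' x + ev b' x * y"
    using assms(2) by (rule fractionsE) blast
  show ?thesis
  proof (rule fractionsI[of "d * d'" _ "d' * a + d * a'" "d' * b + d * b'"])
    fix x y assume "(x, y) \<in> S"
    have "ev (d * d') x * (g (x, y) + h (x, y)) =
        ev d' x * (ev d x * g (x, y)) + ev d x * (ev d' x * h (x, y))"
      by (simp add: algebra_simps)
    also have "\<dots> = ev (d' * a + d * a') x + ev (d' * b + d * b') x * y"
      unfolding g[OF \<open>(x, y) \<in> S\<close>] h[OF \<open>(x, y) \<in> S\<close>] by (simp add: algebra_simps)
    finally show "ev (d * d') x * (g (x, y) + h (x, y)) =
      ev (d' * a + d * a') x + ev (d' * b + d * b') x * y" .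
  qed (simp add: mult_in_D \<open>d \<in> D\<close> \<open>d' \<in> D\<close>)
qed

text \<open>The \<open>y^2\<close> in the product is reduced by the curve equation, whose term
  \<open>1/x\<close> costs one more factor \<open>x\<close> in the denominator; this is the purpose
  of \<open>x_in_D\<close>.\<close>

lemma fractions_mult:
  assumes "g \<in> fractions" "h \<in> fractions"
  shows "(\<lambda>P. g P * h P) \<in> fractions"
proof -
  obtain d a b where "d \<in> D"
    and g: "\<And>x y. (x, y) \<in> S \<Longrightarrow> ev d x * g (x, y) = ev a x + ev b x * y"
    using assms(1) by (rule fractionsE) blast
  obtain d' a' b' where "d' \<in> D"
    and h: "\<And>x y. (x, y) \<in> S \<Longrightarrow> ev d' x * h (x, y) = ev a' x + ev b' x * y"
    using assms(2) by (rule fractionsE) blast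
  let ?X = "[:0, 1:] :: 'k poly"
  show ?thesis
  proof (rule fractionsI)
    show "?X * (d * d') \<in> D" by (intro mult_in_D x_in_D \<open>d \<in> D\<close> \<open>d' \<in> D\<close>)
    fix x y assume xy: "(x, y) \<in> S"
    with S_subset have "x \<noteq> 0" and y: "y\<^sup>2 + y = x ^ (2 * q + 1) + inverse x"
      by (auto simp: acurve_def)
    then have "x * (y\<^sup>2 + y) = x ^ (2 * q + 2) + 1"
      by (simp add: distrib_left)
    then have xy2: "x * y\<^sup>2 = x * y + (x ^ (2 * q + 2) + 1)"
      by (metis add_self_left add.commute distrib_left)
    have "ev (?X * (d * d')) x * (g (x, y) * h (x, y)) =
        x * (ev d x * g (x, y)) * (ev d' x * h (x, y))"
      by (simp add: e_0 e_1 algebra_simps)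
    also have "\<dots> = x * (ev a x * ev a' x) + x * (ev a x * ev b' x + ev a' x * ev b x) * y
        + ev b x * ev b' x * (x * y\<^sup>2)"
      unfolding g[OF xy] h[OF xy] by (simp add: algebra_simps power2_eq_square)
    also have "\<dots> = ev (?X * (a * a') + b * b' * (?X ^ (2 * q + 2) + 1)) x +
        ev (?X * (a * b' + a' * b + b * b')) x * y"
      unfolding xy2 by (simp add: e_0 e_1 algebra_simps)
    finally show "ev (?X * (d * d')) x * (g (x, y) * h (x, y)) =
      ev (?X * (a * a') + b * b' * (?X ^ (2 * q + 2) + 1)) x +
        ev (?X * (a * b' + a' * b + b * b')) x * y" .
  qed
qed

lemma fractions_power: "g \<in> fractions \<Longrightarrow> (\<lambda>P. g P ^ n) \<in> fractions"
  using fractions_const[of 1] by (induction n) (simp_all add: e_1 fractions_mult)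

lemma fractions_sum: "(\<And>i. i \<in> I \<Longrightarrow> g i \<in> fractions) \<Longrightarrow> (\<lambda>P. \<Sum>i\<in>I. g i P) \<in> fractions"
  using fractions_const[of 0]
  by (induction I rule: infinite_finite_induct) (simp_all add: e_0 fractions_add)

lemma fractions_prod: "(\<And>i. i \<in> I \<Longrightarrow> g i \<in> fractions) \<Longrightarrow> (\<lambda>P. \<Prod>i\<in>I. g i P) \<in> fractions"
  using fractions_const[of 1]
  by (induction I rule: infinite_finite_induct) (simp_all add: e_1 fractions_mult)

end

text \<open>The norm of \<open>a + b y\<close>, multiplied by \<open>x\<close> to clear the denominator of \<open>x\<^bsup>-1\<^esup>\<close>.\<close>

definition normp :: "nat \<Rightarrow> 'a::comm_ring_1 poly \<Rightarrow> 'a poly \<Rightarrow> 'a poly"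
  where "normp q a b = [:0, 1:] * (a\<^sup>2 + a * b) + b\<^sup>2 * ([:0, 1:] ^ (2 * q + 2) + 1)"

text \<open>The last two factors are the values of \<open>a + b y\<close> at the conjugate points
  \<open>(x, y)\<close> and \<open>(x, y + 1)\<close>.\<close>

lemma (in field_embedding) ev_normp:
  assumes "(x, y) \<in> acurve q"
  shows "ev (normp q a b) x = x * (ev a x + ev b x * y) * (ev a x + ev b x + ev b x * y)"
proof -
  from assms have "x \<noteq> 0" and y: "y\<^sup>2 + y = x ^ (2 * q + 1) + inverse x"
    by (auto simp: acurve_def)
  then have w: "x ^ (2 * q + 2) + 1 = x * (y\<^sup>2 + y)"
    by (simp add: algebra_simps)
  have "ev (normp q a b) x = x * ((ev a x)\<^sup>2 + ev a x * ev b x) + (ev b x)\<^sup>2 * (x ^ (2 * q + 2) + 1)"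
    by (simp add: normp_def e_0 e_1)
  also have "\<dots> = x * (ev a x + ev b x * y) * (ev a x + ev b x + ev b x * y)"
    unfolding w by (simp add: algebra_simps power2_eq_square)
  finally show ?thesis .
qed

lemma degree_x_power_add_1: "degree ([:0, 1:] ^ (2 * q + 2) + 1 :: 'a::idom poly) = 2 * q + 2"
  by (subst degree_add_eq_left) (simp_all add: degree_power_eq)

text \<open>The outer terms \<open>X a^2\<close> and \<open>b^2 (X^(2q+2) + 1)\<close> have odd and
  even degree, and \<open>X a b\<close> stays below the larger of the two, so nothing cancels. In
  other words, 1 and \<open>y\<close> are linearly independent over K(x).\<close>

lemma normp_eq_0_iff: "normp q a b = 0 \<longleftrightarrow> a = 0 \<and> b = 0" for a b :: "'a::{idom,char2} poly"
proof
  assume 0: "normp q a b = 0"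
  let ?X = "[:0, 1:] :: 'a poly" and ?W = "[:0, 1:] ^ (2 * q + 2) + 1 :: 'a poly"
  have W: "degree ?W = 2 * q + 2" by (rule degree_x_power_add_1)
  then have W0: "?W \<noteq> 0" by force
  have b: "b = 0"
  proof (rule ccontr)
    assume b: "b \<noteq> 0"
    have a: "a \<noteq> 0" using 0 b W0 by (auto simp: normp_def)
    have d1: "degree (?X * a\<^sup>2) = 2 * degree a + 1"
      using a by (simp add: degree_mult_eq degree_power_eq)
    have d2: "degree (b\<^sup>2 * ?W) = 2 * degree b + (2 * q + 2)"
      using b W W0 by (simp add: degree_mult_eq degree_power_eq)
    have d3: "degree (?X * (a * b)) = degree a + degree b + 1"
      using a b by (simp add: degree_mult_eq)
    have sum: "?X * a\<^sup>2 + (?X * (a * b) + b\<^sup>2 * ?W) = 0"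
      using 0 by (simp only: normp_def distrib_left add.assoc)
    consider "degree a > degree b + q" | "degree a \<le> degree b + q" by linarith
    then show False
    proof cases
      case 1
      then have "degree (?X * (a * b) + b\<^sup>2 * ?W) < degree (?X * a\<^sup>2)"
        by (intro degree_add_less) (simp_all only: d1 d2 d3)
      then have "degree (?X * a\<^sup>2 + (?X * (a * b) + b\<^sup>2 * ?W)) = degree (?X * a\<^sup>2)"
        by (rule degree_add_eq_left)
      then show False using sum d1 by simp
    next
      case 2
      then have "degree (?X * a\<^sup>2 + ?X * (a * b)) < degree (b\<^sup>2 * ?W)"
        by (intro degree_add_less) (simp_all only: d1 d2 d3)
      then have "degree ((?X * a\<^sup>2 + ?X * (a * b)) + b\<^sup>2 * ?W) = degree (b\<^sup>2 * ?W)"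
        by (rule degree_add_eq_right)
      then have "2 * degree b + (2 * q + 2) = 0"
        by (simp only: add.assoc sum d2 degree_0)
      then show False by simp
    qed
  qed
  with 0 show "a = 0 \<and> b = 0" by (simp add: normp_def)
qed (simp add: normp_def)

lemma finite_zeros_on_acurve:
  fixes a b :: "'a::{field,char2} poly"
  assumes "a \<noteq> 0 \<or> b \<noteq> 0"
  shows "finite {(x, y). (x, y) \<in> acurve q \<and> poly a x + poly b x * y = 0}" (is "finite ?Z")
proof -
  let ?w = "\<lambda>x::'a. x ^ (2 * q + 1) + inverse x"
  have "?Z \<subseteq> (SIGMA x:{x. poly (normp q a b) x = 0}. {y. poly [:?w x, 1, 1:] y = 0})"
  proof clarify
    fix x y assume xy: "(x, y) \<in> acurve q" and "poly a x + poly b x * y = 0"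
    then have "poly (normp q a b) x = 0"
      using base.ev_normp[OF xy, of a b] by simp
    moreover have "poly [:?w x, 1, 1:] y = 0"
      using xy by (simp add: acurve_def algebra_simps power2_eq_square add_eq_0_iff_eq)
    ultimately show "x \<in> {x. poly (normp q a b) x = 0} \<and> y \<in> {y. poly [:?w x, 1, 1:] y = 0}"
      by blast
  qed
  moreover have "finite \<dots>"
  proof (rule finite_SigmaI)
    show "finite {x. poly (normp q a b) x = 0}"
      using assms by (intro poly_roots_finite) (simp add: normp_eq_0_iff)
    show "finite {y. poly [:?w x, 1, 1:] y = 0}" for x
      by (rule poly_roots_finite) simp
  qed
  ultimately show ?thesis by (rule finite_subset)
qed

section \<open>Places\<close>

text \<open>A place of the curve is encoded by a nonconstant point with Laurent series coordinates.\<close>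

definition places :: "nat \<Rightarrow> ('k::{alg_closed_field,char2} fls \<times> 'k fls) set"
  where "places q = {(x, y) \<in> acurve q. x \<notin> range fls_const}"

abbreviation evl :: "'k::{field,char2} poly \<Rightarrow> 'k fls \<Rightarrow> 'k fls"
  where "evl \<equiv> laurent.ev"

lemma places_conj: "(x, y) \<in> places q \<Longrightarrow> (x, y + 1) \<in> places q"
  by (auto simp: places_def acurve_def power2_add algebra_simps)

text \<open>\<open>p\<close> splits into linear factors and none of them vanishes at
  \<open>x\<close>: a nonconstant series is transcendental over K.\<close>

lemma evl_eq_0_iff:
  fixes p :: "'k::{alg_closed_field,char2} poly"
  assumes x: "x \<notin> range fls_const"
  shows "evl p x = 0 \<longleftrightarrow> p = 0"
proof -
  have "evl p x \<noteq> 0" if "p \<noteq> 0"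
    using that
  proof (induction "degree p" arbitrary: p rule: less_induct)
    case less
    show ?case
    proof (cases "degree p = 0")
      case True
      then show ?thesis using less.prems by (auto elim!: degree_eq_zeroE)
    next
      case False
      then obtain r where "poly p r = 0" using alg_closed_imp_poly_has_root[of p] by auto
      then obtain p1 where p1: "p = [:-r, 1:] * p1" by (auto simp: poly_eq_0_iff_dvd elim: dvdE)
      then have "p1 \<noteq> 0" using less.prems by auto
      then have "degree p = Suc (degree p1)" unfolding p1 by (subst degree_mult_eq) auto
      then have "evl p1 x \<noteq> 0" using less.hyps \<open>p1 \<noteq> 0\<close> by simp
      moreover have "evl [:-r, 1:] x \<noteq> 0" using x by (auto simp: add_eq_0_iff_eq)
      ultimately show ?thesis unfolding p1 laurent.ev_mult by simp
    qed
  qed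
  then show ?thesis by auto
qed

section \<open>Orders of polynomials in a Laurent series\<close>

lemma val_pos_add_const: "val (fls_const r + f) = 0" if "r \<noteq> 0" "f = 0 \<or> val f > 0"
  using that fls_subdegree_add_eq1[of "fls_const r" f] by auto

lemma val_evl_pole:
  fixes p :: "'k::{field,char2} poly"
  assumes "val x < 0" "p \<noteq> 0"
  shows "evl p x \<noteq> 0" "val (evl p x) = int (degree p) * val x"
proof -
  have "evl p x \<noteq> 0 \<and> val (evl p x) = int (degree p) * val x" using assms(2)
  proof (induction p)
    case (pCons a p)
    show ?case
    proof (cases "p = 0")
      case False
      then have IH: "evl p x \<noteq> 0" "val (evl p x) = int (degree p) * val x"
        using pCons by auto
      have "x \<noteq> 0" using assms by auto
      then have v: "val (x * evl p x) = int (Suc (degree p)) * val x" and nz: "x * evl p x \<noteq> 0"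
        using IH by (simp_all add: algebra_simps)
      have "val (x * evl p x) < 0" unfolding v using assms by (simp add: mult_pos_neg)
      then have "val (fls_const a + x * evl p x) = val (x * evl p x)"
        by (intro fls_subdegree_add_eq2[OF nz]) simp
      then show ?thesis using v False \<open>val (x * evl p x) < 0\<close> by auto
    qed (use pCons in auto)
  qed simp
  then show "evl p x \<noteq> 0" "val (evl p x) = int (degree p) * val x" by auto
qed

lemma val_evl_ge_0: "0 \<le> val x \<Longrightarrow> 0 \<le> val (evl p x)"
  by (induction p) (auto intro!: val_add_ge fls_mult_subdegree_ge_0)

text \<open>One root \<open>x0\<close> of \<open>r\<close> is cancelled at a time. At a series
  \<open>x\<close> that reduces to \<open>x0\<close> the denominator vanishes, while
  \<open>p\<close> would be a unit there if \<open>x0\<close> were not a root of \<open>p\<close>.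
  Cancelling leaves the quotient unchanged at all nonconstant \<open>x\<close>, so the hypothesis is
  inherited.\<close>

lemma poly_dvd_of_regular:
  fixes p r :: "'k::{alg_closed_field,char2} poly"
  assumes "r \<noteq> 0"
    and "\<And>x0. \<exists>x. x \<notin> range fls_const \<and> 0 < val (x + fls_const x0) \<and> 0 \<le> val (evl p x / evl r x)"
  shows "r dvd p"
  using assms
proof (induction "degree r" arbitrary: p r rule: less_induct)
  case less
  show ?case
  proof (cases "degree r = 0 \<or> p = 0")
    case True
    then show ?thesis using less.prems(1) by (auto elim!: degree_eq_zeroE simp: const_poly_dvd_iff dvd_field_iff)
  next
    case False
    then obtain x0 where "poly r x0 = 0" using alg_closed_imp_poly_has_root[of r] by auto
    then obtain r1 where r1: "r = [:-x0, 1:] * r1" by (auto simp: poly_eq_0_iff_dvd elim: dvdE)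
    then have nz: "r1 \<noteq> 0" using less.prems by auto
    obtain x where x: "x \<notin> range fls_const" "0 < val (x + fls_const x0)" "0 \<le> val (evl p x / evl r x)"
      using less.prems by blast
    let ?l = "x + fls_const x0"
    have "0 \<le> val (?l + fls_const x0)" by (rule val_add_ge) (use x(2) in auto)
    then have "0 \<le> val x" by (simp add: add.assoc)
    have l: "?l \<noteq> 0" using x by auto
    have evl_l: "evl ([:-x0, 1:] * f) x = ?l * evl f x" for f
      by (simp add: algebra_simps)
    have "poly p x0 = 0"
    proof (rule ccontr)
      assume p0: "poly p x0 \<noteq> 0"
      have "[:-x0, 1:] dvd p - [:poly p x0:]" by (simp only: poly_eq_0_iff_dvd [symmetric]) simp
      then obtain p2 where "p - [:poly p x0:] = [:-x0, 1:] * p2" by (elim dvdE)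
      then have "p = [:poly p x0:] + [:-x0, 1:] * p2" by (metis add.commute diff_add_cancel)
      then have "evl p x = fls_const (poly p x0) + ?l * evl p2 x"
        by (metis evl_l laurent.ev_add laurent.ev_pCons laurent.ev_0 mult_zero_right add_0_right)
      moreover have "?l * evl p2 x = 0 \<or> val (?l * evl p2 x) > 0"
        using val_evl_ge_0[OF \<open>0 \<le> val x\<close>, of p2] x(2) l
        by (cases "evl p2 x = 0") (auto simp del: distrib_right)
      ultimately have "val (evl p x) = 0" using val_pos_add_const p0 by metis
      moreover have "val (evl r x) > 0"
        using val_evl_ge_0[OF \<open>0 \<le> val x\<close>, of r1] x l nz
        by (simp only: r1 evl_l) (simp add: evl_eq_0_iff)
      moreover have "evl p x \<noteq> 0" "evl r x \<noteq> 0" using x False less.prems by (auto simp: evl_eq_0_iff)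
      ultimately show False using x(3) by (simp add: divide_inverse)
    qed
    then obtain p1 where p1: "p = [:-x0, 1:] * p1" by (auto simp: poly_eq_0_iff_dvd elim: dvdE)
    have deg: "degree r = Suc (degree r1)" unfolding r1 using nz by (subst degree_mult_eq) auto
    have eq: "evl p x / evl r x = evl p1 x / evl r1 x" if "x \<notin> range fls_const" for x
    proof -
      have "evl [:-x0, 1:] x \<noteq> 0" using that by (simp add: evl_eq_0_iff del: laurent.ev_pCons)
      then show ?thesis unfolding p1 r1 laurent.ev_mult by (rule mult_divide_mult_cancel_left)
    qed
    have "r1 dvd p1"
      using less.hyps[of r1 p1] deg nz less.prems(2) eq by (metis lessI)
    then show ?thesis unfolding p1 r1 by (rule mult_dvd_mono[OF dvd_refl])
  qed
qed

section \<open>Construction of places by power series\<close>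

lemma fps_power_nth_cong:
  fixes f g :: "'a::comm_ring_1 fps"
  assumes "\<And>i. i \<le> n \<Longrightarrow> fps_nth f i = fps_nth g i"
  shows "fps_nth (f ^ N) n = fps_nth (g ^ N) n"
  using assms
proof (induction N arbitrary: n)
  case (Suc N)
  then show ?case by (simp add: fps_mult_nth)
qed simp

text \<open>Because of the factor \<open>fps_X\<close>, coefficient \<open>n\<close> of the
  right-hand side involves only coefficients of \<open>f\<close> below \<open>n\<close>. This
  contraction takes the place of Hensel's lemma.\<close>

lemma fps_fixpoint_exists:
  fixes u :: "'a::comm_ring_1 fps"
  shows "\<exists>f. f = u + fps_X * f ^ N"
proof -
  define F where "F f = u + fps_X * f ^ N" for f
  define f where "f j = (F ^^ j) 0" for j
  have F_cong: "fps_nth (F g) n = fps_nth (F h) n"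
    if "\<And>i. i < n \<Longrightarrow> fps_nth g i = fps_nth h i" for g h n
    using that fps_power_nth_cong[of "n - 1" g h N] unfolding F_def by (cases n) auto
  have step: "fps_nth (f (Suc j)) i = fps_nth (f j) i" if "i < j" for i j
    using that
  proof (induction j arbitrary: i)
    case (Suc j)
    have "fps_nth (F (f (Suc j))) i = fps_nth (F (f j)) i"
      by (rule F_cong) (use Suc in auto)
    then show ?case by (simp add: f_def)
  qed simp
  \<comment> \<open>Coefficient \<open>i\<close> no longer changes from iterate \<open>i + 1\<close>
    on, so the limit is read off the diagonal.\<close>
  define g where "g = Abs_fps (\<lambda>i. fps_nth (f (Suc i)) i)"
  have agree: "fps_nth g i = fps_nth (f j) i" if "i < j" for i j
    using that
  proof (induction j)
    case (Suc j)
    then show ?case using step[of i j] by (cases "i = j") (auto simp: g_def)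
  qed simp
  have "fps_nth g n = fps_nth (F g) n" for n
  proof -
    have "fps_nth (F g) n = fps_nth (F (f n)) n" by (rule F_cong) (rule agree)
    then show ?thesis by (simp add: g_def f_def)
  qed
  then have "g = F g" by (simp add: fps_eq_iff)
  then show ?thesis unfolding F_def by blast
qed

text \<open>In characteristic two the equation is \<open>c = w + c^2\<close>; with
  \<open>w = X w1\<close> and \<open>c = X f\<close> it becomes the fixed-point equation
  \<open>f = w1 + X f^2\<close>.\<close>

lemma artin_schreier_solvable:
  fixes w :: "'a::{field,char2} fps"
  assumes "fps_nth w 0 = 0"
  shows "\<exists>c. fps_nth c 0 = 0 \<and> (fps_to_fls c)\<^sup>2 + fps_to_fls c = fps_to_fls w"
proof -
  define w1 where "w1 = fps_shift 1 w"
  have w: "w = fps_X * w1" using assms by (simp add: w1_def fps_shift_times_fps_X')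
     (rule fps_ext, simp)
  obtain f where f: "f = w1 + fps_X * f ^ 2" using fps_fixpoint_exists by blast
  have "w1 = f - fps_X * f\<^sup>2" using f by (simp add: algebra_simps)
  then have "w = fps_X * (f - fps_X * f\<^sup>2)" unfolding w by (rule arg_cong)
  then have "w = fps_X * f - (fps_X * f)\<^sup>2"
    by (simp add: right_diff_distrib power2_eq_square mult_ac)
  then have "fps_to_fls w = fps_to_fls (fps_X * f - (fps_X * f)\<^sup>2)" by (rule arg_cong)
  then have "fps_to_fls w = fps_to_fls (fps_X * f) - (fps_to_fls (fps_X * f))\<^sup>2"
    by (simp only: fps_to_fls_minus fps_to_fls_power)
  then show ?thesis
    by (intro exI[of _ "fps_X * f"]) (simp add: add.commute)
qed

lemma val_fps_to_fls_ge_0: "0 \<le> val (fps_to_fls f)"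
  by (rule fls_subdegree_fls_to_fps_gt0)

lemma nonconst_if_val: "val x \<noteq> 0 \<Longrightarrow> x \<notin> range fls_const"
  by auto

text \<open>The double cover is ramified at infinity, hence the double pole of \<open>x\<close>. The
  last value says that dx/x has a zero of order \<open>2 q\<close> there, one less than the pole
  order of \<open>y\<close>; \<open>holomorphic_imp_rational\<close> rests on this margin.\<close>

lemma place_at_infinity_exists:
  assumes q: "even q"
  obtains x y :: "'k::{alg_closed_field,char2} fls" where "(x, y) \<in> places q" "val x = -2"
    "val y = - (2 * int q + 1)" "dt x \<noteq> 0" "val (x / dt x) = - 2 * int q"
proof -
  \<comment> \<open>Put \<open>s = 1/x\<close>. The leading part \<open>x^q / t\<close> of
    \<open>y\<close> is to solve the equation with \<open>x^(2q+1)\<close> alone on the right;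
    cleared of denominators, this is \<open>s = t^2 + t s^(q+1)\<close>. The remaining summand
    \<open>1/x = s\<close> is absorbed by \<open>c\<close>.\<close>
  obtain s0 :: "'k fps" where s0: "s0 = fps_X\<^sup>2 + fps_X * s0 ^ (q + 1)"
    using fps_fixpoint_exists by blast
  have "fps_nth s0 0 = fps_nth (fps_X\<^sup>2 + fps_X * s0 ^ (q + 1)) 0"
    by (rule arg_cong[OF s0])
  then have s0_0: "fps_nth s0 0 = 0" by simp
  define t :: "'k fls" where "t = fls_X"
  define s where "s = fps_to_fls s0"
  define m where "m = 1 + t * s ^ q"
  have "fps_to_fls s0 = fps_to_fls (fps_X\<^sup>2 + fps_X * s0 ^ (q + 1))"
    by (rule arg_cong[OF s0])
  then have s: "s = t\<^sup>2 + t * s ^ (q + 1)"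
    by (simp only: s_def t_def fps_to_fls_plus fls_times_fps_to_fls fps_to_fls_power fps_X_to_fls)
  have "s * m = s + t * s ^ (q + 1)" by (simp add: m_def algebra_simps)
  also have "\<dots> = t\<^sup>2 + (t * s ^ (q + 1) + t * s ^ (q + 1))"
    using s by (metis add.assoc)
  finally have sm: "s * m = t\<^sup>2" by (simp only: add_self add_0_right)
  have t: "val t = 1" "t \<noteq> 0" by (simp_all add: t_def)
  with sm have nz: "s \<noteq> 0" "m \<noteq> 0" by auto
  have "0 \<le> val s" by (simp add: s_def val_fps_to_fls_ge_0)
  then have "0 < val (t * s ^ q)"
    using t nz by (simp add: fls_subdegree_pow add_pos_nonneg)
  then have vm: "val m = 0"
    using fls_subdegree_add_eq1[of 1 "t * s ^ q"] by (simp add: m_def)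
  have vs: "val s = 2"
    using arg_cong[OF sm, of val] nz vm by (simp add: fls_subdegree_pow t)
  obtain c where c: "(fps_to_fls c)\<^sup>2 + fps_to_fls c = s"
    using artin_schreier_solvable[OF s0_0] by (auto simp: s_def)
  define x where "x = inverse s"
  define y where "y = x ^ q / t + fps_to_fls c"
  have x0: "x \<noteq> 0" using nz by (simp add: x_def)
  have vx: "val x = -2" by (simp add: x_def vs)
  have "val (x ^ q / t) = - (2 * int q + 1)"
    using x0 t by (simp add: divide_inverse fls_subdegree_pow vx)
  then have vy: "val y = - (2 * int q + 1)"
    unfolding y_def using x0 t val_fps_to_fls_ge_0[of c]
    by (subst fls_subdegree_add_eq1) auto
  have "(x ^ q / t)\<^sup>2 + x ^ q / t = x ^ (2 * q) * (m / t\<^sup>2)"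
  proof -
    have "x ^ q * s ^ q = 1" using nz by (simp add: x_def flip: power_mult_distrib)
    then have xs: "x ^ q * (x ^ q * s ^ q) = x ^ q" by simp
    have x2: "x ^ (2 * q) = x ^ q * x ^ q" by (simp add: mult_2 power_add)
    have "x ^ (2 * q) * (m / t\<^sup>2) = (x ^ q / t)\<^sup>2 + x ^ q * (x ^ q * s ^ q) / t"
      using t unfolding m_def x2 by (simp add: field_simps power2_eq_square)
    then show ?thesis unfolding xs ..
  qed
  also have "m / t\<^sup>2 = x" using sm t nz by (simp add: x_def field_simps)
  finally have y: "y\<^sup>2 + y = x ^ (2 * q + 1) + inverse x"
    using c unfolding y_def by (simp add: power2_add x_def algebra_simps)
  \<comment> \<open>As \<open>s m\<close> is a square, \<open>ds m = s dm = s^(q+1)\<close>, which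
    gives ds the order \<open>2 q + 2\<close>.\<close>
  have "dt (s * m) = 0" unfolding sm by simp
  moreover have "dt m = s ^ q"
    using q by (simp add: m_def t_def fls_deriv_power of_nat_char2)
  ultimately have ds: "dt s * m = s ^ (q + 1)"
    by (simp add: add_eq_0_iff_eq)
  then have ds0: "dt s \<noteq> 0" using nz by auto
  have dx: "dt x = dt s * x\<^sup>2" by (simp add: x_def dt_inverse_char2)
  have "val (dt s) = 2 * (int q + 1)"
    using arg_cong[OF ds, of val] nz ds0 vm vs by (simp add: fls_subdegree_pow)
  then have "val (x / dt x) = - 2 * int q"
    using ds0 x0 by (simp add: dx divide_inverse vx fls_subdegree_pow)
  moreover have "(x, y) \<in> places q"
    using nonconst_if_val[of x] vx x0 y by (simp add: places_def acurve_def)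
  moreover have "dt x \<noteq> 0" using dx ds0 x0 by simp
  ultimately show ?thesis using that vx vy by blast
qed

text \<open>The part \<open>1/t\<close> of \<open>y\<close> accounts for \<open>1/x\<close>: from
  \<open>1/t^2 + 1/t = 1/x\<close> comes \<open>x = t^2 / (1 + t)\<close>, and a regular
  \<open>c\<close> takes care of \<open>x^(2q+1)\<close>. Since \<open>x (1 + t)\<close> is a
  square, \<open>x / dt x = 1 + t\<close> is a unit.\<close>

lemma place_at_0_exists:
  obtains x y :: "'k::{alg_closed_field,char2} fls" where "(x, y) \<in> places q" "0 < val x"
    "dt x \<noteq> 0" "0 \<le> val (x / dt x)"
proof -
  define t :: "'k fls" where "t = fls_X"
  define x0 :: "'k fps" where "x0 = fps_X\<^sup>2 * inverse (1 + fps_X)"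
  define x where "x = fps_to_fls x0"
  have "x0 * (1 + fps_X) = fps_X\<^sup>2"
    unfolding x0_def mult.assoc by (subst inverse_mult_eq_1) simp_all
  then have "fps_to_fls (x0 * (1 + fps_X)) = fps_to_fls (fps_X\<^sup>2)" by simp
  then have xt: "x * (1 + t) = t\<^sup>2"
    by (simp only: x_def t_def fls_times_fps_to_fls fps_to_fls_plus fps_one_to_fls fps_X_to_fls fps_to_fls_power)
  have t: "val t = 1" "t \<noteq> 0" by (simp_all add: t_def)
  have vt: "val (1 + t) = 0" using fls_subdegree_add_eq1[of 1 t] t by simp
  have nz: "x \<noteq> 0" "1 + t \<noteq> 0" using xt t by auto
  have vx: "val x = 2" using arg_cong[OF xt, of val] nz vt by (simp add: fls_subdegree_pow t)
  have "fps_nth (x0 ^ (2 * q + 1)) 0 = 0" by (simp add: x0_def fps_nth_power_0)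
  then obtain c where "(fps_to_fls c)\<^sup>2 + fps_to_fls c = fps_to_fls (x0 ^ (2 * q + 1))"
    using artin_schreier_solvable by blast
  then have c: "(fps_to_fls c)\<^sup>2 + fps_to_fls c = x ^ (2 * q + 1)"
    by (simp only: x_def fps_to_fls_power)
  define y where "y = inverse t + fps_to_fls c"
  have "inverse x = (inverse t)\<^sup>2 + inverse t"
    using xt nz t by (simp add: field_simps power2_eq_square)
  then have y: "y\<^sup>2 + y = x ^ (2 * q + 1) + inverse x"
    unfolding y_def power2_add c [symmetric] by (simp add: algebra_simps)
  have "dt (x * (1 + t)) = 0" unfolding xt by simp
  then have dx: "x = dt x * (1 + t)" by (simp add: t_def add_eq_0_iff_eq)
  then have dx0: "dt x \<noteq> 0" using nz by auto
  then have "x / dt x = 1 + t" using dx by (metis nonzero_mult_div_cancel_left)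
  then have "0 \<le> val (x / dt x)" using vt by simp
  moreover have "(x, y) \<in> places q"
    using nonconst_if_val[of x] vx nz y by (simp add: places_def acurve_def)
  ultimately show ?thesis using that vx dx0 by simp
qed

text \<open>Unramified case: \<open>x = r + t\<close>, and \<open>y\<close> lifts a root
  \<open>b\<close> of the reduced equation, because the right-hand side minus its constant term
  \<open>w\<close> is in the range of \<open>artin_schreier_solvable\<close>.\<close>

lemma place_at_nonzero_exists:
  fixes r :: "'k::{alg_closed_field,char2}"
  assumes "r \<noteq> 0"
  obtains x y where "(x, y) \<in> places q" "0 < val (x + fls_const r)"
    "dt x \<noteq> 0" "0 \<le> val (x / dt x)"
proof -
  define w where "w = r ^ (2 * q + 1) + inverse r"
  obtain b where "poly [:w, 1, 1:] b = 0"
    using alg_closed_imp_poly_has_root[of "[:w, 1, 1:]"] by auto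
  then have "w + (b\<^sup>2 + b) = 0"
    by (simp add: algebra_simps power2_eq_square)
  then have b: "b\<^sup>2 + b = w" by (simp only: add_eq_0_iff_eq)
  define x0 where "x0 = fps_const r + fps_X"
  define x where "x = fps_to_fls x0"
  have x: "x = fls_const r + fls_X" by (simp add: x_def x0_def fps_to_fls_plus)
  have sub: "subdegree x0 = 0" using assms by (simp add: x0_def)
  have "fps_nth (x0 ^ (2 * q + 1) + inverse x0 + fps_const (- w)) 0 = 0"
    by (simp add: x0_def w_def fps_nth_power_0)
  then obtain c where "(fps_to_fls c)\<^sup>2 + fps_to_fls c =
      fps_to_fls (x0 ^ (2 * q + 1) + inverse x0 + fps_const (- w))"
    using artin_schreier_solvable by blast
  also have "\<dots> = x ^ (2 * q + 1) + inverse x + fls_const w"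
    using sub by (simp add: x_def fps_to_fls_plus fps_to_fls_power fls_inverse_fps_to_fls del: power_Suc)
  finally have c: "(fps_to_fls c)\<^sup>2 + fps_to_fls c = x ^ (2 * q + 1) + inverse x + fls_const w" .
  define y where "y = fls_const b + fps_to_fls c"
  have "(fls_const b)\<^sup>2 + fls_const b = fls_const w"
    unfolding b [symmetric] by (simp only: fls_plus_const [symmetric] fls_const_power)
  then have "y\<^sup>2 + y = fls_const w + ((fps_to_fls c)\<^sup>2 + fps_to_fls c)"
    unfolding y_def power2_add by (metis add.assoc add.left_commute)
  then have y: "y\<^sup>2 + y = x ^ (2 * q + 1) + inverse x"
    unfolding c by (simp add: algebra_simps)
  have dx: "dt x = 1" by (simp add: x)
  have v: "val (x + fls_const r) = 1" by (simp add: x algebra_simps)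
  have nc: "x \<notin> range fls_const"
  proof
    assume "x \<in> range fls_const"
    then have "dt x = 0" by auto
    with dx show False by simp
  qed
  then have "x \<noteq> 0" by (metis fls_const_0 rangeI)
  have "(x, y) \<in> places q" using nc \<open>x \<noteq> 0\<close> y by (simp add: places_def acurve_def)
  moreover have "0 \<le> val (x / dt x)" unfolding dx by (simp add: x_def val_fps_to_fls_ge_0)
  ultimately show ?thesis using that v dx by simp
qed

lemma finite_place_exists:
  obtains x y :: "'k::{alg_closed_field,char2} fls" where "(x, y) \<in> places q" "0 < val (x + fls_const r)"
    "dt x \<noteq> 0" "0 \<le> val (x / dt x)"
  by (cases "r = 0") (auto intro: place_at_0_exists place_at_nonzero_exists that)

section \<open>Holomorphic differentials\<close>

lemma val_add_distinct:
  assumes "f \<noteq> 0" "g \<noteq> 0" "val f \<noteq> val g"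
  shows "f + g \<noteq> 0" "val (f + g) = min (val f) (val g)"
proof -
  show v: "val (f + g) = min (val f) (val g)"
    using assms fls_subdegree_add_eq1[of f g] fls_subdegree_add_eq2[of g f]
    by (cases "val f < val g") (auto simp: min_def)
  have "fls_nth (f + g) (min (val f) (val g)) \<noteq> 0"
    using assms by (cases "val f < val g") (auto simp: min_def)
  then show "f + g \<noteq> 0" by (metis fls_zero_nth)
qed

text \<open>The assumption says that \<open>f dx/x\<close> is holomorphic, where \<open>f = (A + B y) / R\<close>. The trace
  \<open>B / R\<close> of \<open>f\<close> is then regular at all finite places, hence a polynomial; at infinity, no
  cancellation between \<open>A / R\<close> and \<open>(B / R) y\<close> is possible because the valuation of \<open>y\<close> is odd
  while those of elements of \<open>K(x)\<close> are even.\<close>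

lemma holomorphic_imp_rational:
  fixes A B R :: "'k::{alg_closed_field,char2} poly"
  assumes q: "even q" and R: "R \<noteq> 0"
    and reg: "\<And>x y. (x, y) \<in> places q \<Longrightarrow> dt x \<noteq> 0 \<Longrightarrow>
      \<exists>g. 0 \<le> val g \<and> (evl A x + evl B x * y) / evl R x = x / dt x * g"
  shows "B = 0" "R dvd A"
proof -
  have "R dvd B"
  proof (rule poly_dvd_of_regular[OF R])
    fix r
    obtain x y :: "'k fls" where xy: "(x, y) \<in> places q" "0 < val (x + fls_const r)" "dt x \<noteq> 0" "0 \<le> val (x / dt x)"
      by (rule finite_place_exists)
    obtain g where g: "0 \<le> val g" "(evl A x + evl B x * y) / evl R x = x / dt x * g"
      using reg xy by blast
    obtain h where h: "0 \<le> val h" "(evl A x + evl B x * (y + 1)) / evl R x = x / dt x * h"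
      using reg[OF places_conj] xy by blast
    have "evl B x / evl R x =
        (evl A x + evl B x * y) / evl R x + (evl A x + evl B x * (y + 1)) / evl R x"
      unfolding add_divide_distrib [symmetric] by (simp add: algebra_simps)
    also have "\<dots> = x / dt x * (g + h)" unfolding g(2) h(2) by (simp only: distrib_left)
    finally have "0 \<le> val (evl B x / evl R x)"
      using fls_mult_subdegree_ge_0[OF xy(4) val_add_ge[OF g(1) h(1)]] by simp
    then show "\<exists>x. x \<notin> range fls_const \<and> 0 < val (x + fls_const r) \<and> 0 \<le> val (evl B x / evl R x)"
      using xy by (auto simp: places_def)
  qed
  then obtain s where s: "B = R * s" by (elim dvdE)
  show B: "B = 0"
  proof (rule ccontr)
    assume "B \<noteq> 0"
    then have "s \<noteq> 0" using s by auto
    obtain x y :: "'k fls" where xy: "(x, y) \<in> places q" "val x = -2"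
      "val y = - (2 * int q + 1)" "dt x \<noteq> 0" "val (x / dt x) = - 2 * int q"
      using place_at_infinity_exists[OF q] by blast
    obtain g where g: "0 \<le> val g" "(evl A x + evl B x * y) / evl R x = x / dt x * g"
      using reg xy by blast
    have neg: "val x < 0" using xy by simp
    note ev_nz = val_evl_pole(1)[OF neg] and val_ev = val_evl_pole(2)[OF neg]
    have y: "y \<noteq> 0" using xy by auto
    have "evl B x = evl R x * evl s x" unfolding s by simp
    then have f: "x / dt x * g = evl A x / evl R x + evl s x * y"
      unfolding g(2) [symmetric] using ev_nz[OF R] by (simp add: add_divide_distrib)
    have v1: "val (evl s x * y) = - 2 * int (degree s) - (2 * int q + 1)" and n1: "evl s x * y \<noteq> 0"
      using ev_nz[OF \<open>s \<noteq> 0\<close>] y by (simp_all add: val_ev[OF \<open>s \<noteq> 0\<close>] xy)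
    \<comment> \<open>A regular \<open>g\<close> and a pole of order \<open>2 q\<close> of
      \<open>x / dt x\<close> permit a pole of order at most \<open>2 q\<close>, so order
      \<open>2 q + 1\<close> is already too much.\<close>
    have "x / dt x * g \<noteq> 0 \<and> val (x / dt x * g) \<le> - (2 * int q + 1)"
    proof (cases "A = 0")
      case True
      then show ?thesis unfolding f using v1 n1 by simp
    next
      case False
      have v2: "val (evl A x / evl R x) = 2 * (int (degree R) - int (degree A))"
        and n2: "evl A x / evl R x \<noteq> 0"
        using ev_nz[OF False] ev_nz[OF R]
        by (simp_all add: divide_inverse val_ev[OF False] val_ev[OF R] xy)
      have "val (evl A x / evl R x) \<noteq> val (evl s x * y)"
        unfolding v1 v2 by presburger
      from val_add_distinct[OF n2 n1 this] show ?thesis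
        unfolding f using v1 by simp
    qed
    moreover from this have "val (x / dt x * g) = val (x / dt x) + val g"
      by (intro fls_subdegree_mult) auto
    ultimately show False using xy g by linarith
  qed
  show "R dvd A"
  proof (rule poly_dvd_of_regular[OF R])
    fix r
    obtain x y :: "'k fls" where xy: "(x, y) \<in> places q" "0 < val (x + fls_const r)" "dt x \<noteq> 0" "0 \<le> val (x / dt x)"
      by (rule finite_place_exists)
    then obtain g where "0 \<le> val g" "evl A x / evl R x = x / dt x * g"
      using reg[of x y] B by auto
    then have "0 \<le> val (evl A x / evl R x)"
      using fls_mult_subdegree_ge_0 xy(4) by metis
    then show "\<exists>x. x \<notin> range fls_const \<and> 0 < val (x + fls_const r) \<and> 0 \<le> val (evl A x / evl R x)"
      using xy by (auto simp: places_def)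
  qed
qed

section \<open>The derivation \<open>x d/dx\<close> and its values on solutions\<close>

lemma dt_evl: "dt (evl p x) = evl (pderiv p) x * dt x"
  by (induction p) (simp_all add: pderiv_pCons algebra_simps)

lemma dt_curve:
  fixes x y :: "'k::{field,char2} fls"
  assumes "(x, y) \<in> acurve q"
  shows "x\<^sup>2 * dt y = dt x * (x ^ (2 * q + 2) + 1)"
proof -
  from assms have "x \<noteq> 0" and y: "y\<^sup>2 + y = x ^ (2 * q + 1) + inverse x"
    by (auto simp: acurve_def)
  have "dt y = dt (y\<^sup>2 + y)" by simp
  also have "\<dots> = dt x * (x ^ (2 * q) + (inverse x)\<^sup>2)"
    unfolding y by (simp add: dt_inverse_char2 fls_deriv_power of_nat_char2 algebra_simps del: power_Suc)
  finally show ?thesis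
    using \<open>x \<noteq> 0\<close> by (simp add: field_simps power2_eq_square)
qed

text \<open>The derivation \<open>x d/dx\<close> of the function field, in coordinates:
  it maps \<open>(a + b y) / d\<close> to \<open>(diff_a + diff_b y) / (x d\<^sup>2)\<close>.\<close>

definition diff_a :: "nat \<Rightarrow> 'a::idom poly \<Rightarrow> 'a poly \<Rightarrow> 'a poly \<Rightarrow> 'a poly"
  where "diff_a q a b d = [:0, 1:]\<^sup>2 * pderiv (a * d) + b * d * ([:0, 1:] ^ (2 * q + 2) + 1)"

definition diff_b :: "'a::idom poly \<Rightarrow> 'a poly \<Rightarrow> 'a poly"
  where "diff_b b d = [:0, 1:]\<^sup>2 * pderiv (b * d)"

text \<open>In characteristic two the quotient rule reads (n/d)' = (n d)' / d^2, hence the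
  derivatives of \<open>a d\<close> and \<open>b d\<close>. The extra summand of
  \<open>diff_a\<close> comes from dy/dx = (x^(2q+2) + 1) / x^2.\<close>

lemma derivation_coordinates:
  fixes x y f :: "'k::{alg_closed_field,char2} fls"
  assumes xy: "(x, y) \<in> acurve q" and nz: "evl d x \<noteq> 0" "dt x \<noteq> 0"
    and f: "evl d x * f = evl a x + evl b x * y"
  shows "(evl (diff_a q a b d) x + evl (diff_b b d) x * y) / evl ([:0, 1:] * d\<^sup>2) x = x / dt x * dt f"
proof -
  have x: "x \<noteq> 0" using xy by (simp add: acurve_def)
  have "dt (evl d x * f) = dt (evl a x + evl b x * y)" unfolding f ..
  then have "evl d x * dt f + evl (pderiv d) x * dt x * f =
      evl (pderiv a) x * dt x + (evl b x * dt y + evl (pderiv b) x * dt x * y)"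
    by (simp add: dt_evl)
  then have *: "evl d x * dt f = evl (pderiv d) x * dt x * f +
      (evl (pderiv a) x * dt x + (evl b x * dt y + evl (pderiv b) x * dt x * y))"
    by (metis add_self_left add.commute)
  have "x\<^sup>2 * (evl d x)\<^sup>2 * dt f = x\<^sup>2 * evl d x * (evl d x * dt f)"
    by (simp add: power2_eq_square algebra_simps)
  also have "\<dots> = x\<^sup>2 * evl (pderiv d) x * dt x * (evl d x * f) +
      x\<^sup>2 * evl d x * dt x * (evl (pderiv a) x + evl (pderiv b) x * y) +
      evl d x * evl b x * (x\<^sup>2 * dt y)"
    unfolding * by (simp add: algebra_simps)
  also have "\<dots> = dt x * (evl (diff_a q a b d) x + evl (diff_b b d) x * y)"
    unfolding f dt_curve[OF xy] diff_a_def diff_b_def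
    by (simp add: pderiv_mult algebra_simps)
  finally show ?thesis
    using nz x by (simp add: field_simps power2_eq_square)
qed

text \<open>\<open>holomorphic_imp_rational\<close> is applied to du and then to du/u. Write
  \<open>A\<close> for \<open>diff_a q a b d\<close> and \<open>N\<close> for the norm. Once
  \<open>diff_b b d = 0\<close> is known, expanding by the conjugate \<open>a + b + b y\<close>
  turns the second function into \<open>A (a + b + b y) / (d N)\<close>, whose \<open>y\<close>-part
  is \<open>A b\<close>.\<close>

lemma solution_differentials:
  fixes a b d :: "'k::{alg_closed_field,char2} poly"
  assumes q: "even q" "q \<ge> 2" and d: "d \<noteq> 0"
    and u: "\<And>x y. (x, y) \<in> places q \<Longrightarrow> evl d x * u (x, y) = evl a x + evl b x * y"
    and nz: "\<And>P. P \<in> places q \<Longrightarrow> u P \<noteq> 0"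
    and eq: "\<And>P. P \<in> places q \<Longrightarrow> (v P)\<^sup>2 + v P = u P ^ (q + 1) + inverse (u P)"
  shows "diff_b b d = 0" "[:0, 1:] * d\<^sup>2 dvd diff_a q a b d"
    "diff_a q a b d = 0 \<or> b = 0" "d * normp q a b dvd diff_a q a b d * (a + b)"
proof -
  let ?A = "diff_a q a b d" and ?B = "diff_b b d" and ?R = "[:0, 1:] * d\<^sup>2"
  have evd: "evl d x \<noteq> 0" if "(x, y) \<in> places q" for x y
    using that d by (auto simp: places_def evl_eq_0_iff)
  have der: "(evl ?A x + evl ?B x * y) / evl ?R x = x / dt x * dt (u (x, y))"
    if "(x, y) \<in> places q" "dt x \<noteq> 0" for x y
    using that by (intro derivation_coordinates evd u) (auto simp: places_def)
  have "?R \<noteq> 0" using d by simp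
  note hol = holomorphic_imp_rational[OF q(1) this, of ?A ?B]
  have reg: "\<exists>g. 0 \<le> val g \<and> (evl ?A x + evl ?B x * y) / evl ?R x = x / dt x * g"
    if "(x, y) \<in> places q" "dt x \<noteq> 0" for x y
    using der[OF that] artin_schreier_differentials_regular(1)[OF q nz eq] that by blast
  show B: "?B = 0" and "?R dvd ?A" by (rule hol; fact reg)+
  obtain x0 y0 :: "'k fls" where P0: "(x0, y0) \<in> places q"
    using place_at_infinity_exists[OF q(1)] by blast
  have m0: "normp q a b \<noteq> 0"
    using u[OF P0] nz[OF P0] evd[OF P0] by (auto simp: normp_eq_0_iff)
  then have R': "d * normp q a b \<noteq> 0" using d by simp
  have reg': "\<exists>g. 0 \<le> val g \<and>
      (evl (?A * (a + b)) x + evl (?A * b) x * y) / evl (d * normp q a b) x = x / dt x * g"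
    if xy: "(x, y) \<in> places q" "dt x \<noteq> 0" for x y
  proof (intro exI conjI)
    show "0 \<le> val (dt (u (x, y)) / u (x, y))"
      using artin_schreier_differentials_regular(2)[OF q nz eq] xy by blast
    let ?c = "evl a x + evl b x + evl b x * y"
    have c: "(x, y) \<in> acurve q" "x \<notin> range fls_const" using xy by (auto simp: places_def)
    have m: "evl (normp q a b) x = x * (evl d x * u (x, y)) * ?c"
      using laurent.ev_normp[OF c(1)] u[OF xy(1)] by simp
    then have c0: "?c \<noteq> 0" using m0 c(2) by (auto simp: evl_eq_0_iff)
    have "(evl (?A * (a + b)) x + evl (?A * b) x * y) / evl (d * normp q a b) x
        = (evl ?A x * ?c) / (evl d x * (x * (evl d x * u (x, y))) * ?c)"
      unfolding laurent.ev_mult m by (simp add: algebra_simps)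
    also have "\<dots> = evl ?A x / (evl d x * (x * (evl d x * u (x, y))))"
      using c0 by simp
    also have "\<dots> = (evl ?A x + evl ?B x * y) / evl ?R x / u (x, y)"
      unfolding B by (simp add: power2_eq_square mult_ac)
    also have "\<dots> = x / dt x * (dt (u (x, y)) / u (x, y))"
      unfolding der[OF xy] by simp
    finally show "(evl (?A * (a + b)) x + evl (?A * b) x * y) / evl (d * normp q a b) x = \<dots>" .
  qed
  note hol' = holomorphic_imp_rational[OF q(1) R', of "?A * (a + b)" "?A * b"]
  have "?A * b = 0" by (rule hol'; fact reg')
  then show "?A = 0 \<or> b = 0" by simp
  show "d * normp q a b dvd ?A * (a + b)" by (rule hol'; fact reg')
qed

section \<open>The function field\<close>

text \<open>Functions on the places replace a quotient field. Their values elsewhere are arbitrary,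
  and by \<open>evl_coordinates_eq_0\<close> the value at a single place determines the function on
  all places.\<close>

definition function_field :: "nat \<Rightarrow> ('k::{alg_closed_field,char2} fls \<times> 'k fls \<Rightarrow> 'k fls) set"
  where "function_field q = curve_functions.fractions fls_const {d. d \<noteq> 0} (places q)"

interpretation places: curve_functions fls_const q "{d. d \<noteq> 0}" "places q"
  for q :: nat
  by unfold_locales (auto simp: places_def)

lemmas function_field_add = places.fractions_add[folded function_field_def]
lemmas function_field_mult = places.fractions_mult[folded function_field_def]
lemmas function_field_power = places.fractions_power[folded function_field_def]

lemma function_fieldE:
  assumes "g \<in> function_field q"
  obtains a b d where "d \<noteq> 0" "\<And>x y. (x, y) \<in> places q \<Longrightarrow> evl d x * g (x, y) = evl a x + evl b x * y"
  using assms unfolding function_field_def by (rule places.fractionsE) blast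

lemma function_fieldI:
  assumes "d \<noteq> 0" "\<And>x y. (x, y) \<in> places q \<Longrightarrow> evl d x * g (x, y) = evl a x + evl b x * y"
  shows "g \<in> function_field q"
  using assms unfolding function_field_def by (intro places.fractionsI[of d]) auto

text \<open>The norm of \<open>a + b y\<close> is a polynomial that vanishes at the transcendental
  \<open>x\<close>, hence is zero.\<close>

lemma evl_coordinates_eq_0:
  fixes a b :: "'k::{alg_closed_field,char2} poly"
  assumes "(x, y) \<in> places q" "evl a x + evl b x * y = 0"
  shows "a = 0" "b = 0"
proof -
  have "evl (normp q a b) x = 0"
    using assms laurent.ev_normp[of x y q a b] by (simp add: places_def)
  then have "normp q a b = 0" using assms by (simp add: places_def evl_eq_0_iff)
  then show "a = 0" "b = 0" by (simp_all add: normp_eq_0_iff)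
qed

lemma function_field_inverse:
  fixes g :: "'k::{alg_closed_field,char2} fls \<times> 'k fls \<Rightarrow> 'k fls"
  assumes "g \<in> function_field q"
  shows "(\<lambda>P. inverse (g P)) \<in> function_field q"
proof -
  obtain a b d :: "'k poly" where d: "d \<noteq> 0"
    and g: "\<And>x y. (x, y) \<in> places q \<Longrightarrow> evl d x * g (x, y) = evl a x + evl b x * y"
    using assms by (rule function_fieldE) blast
  have evd: "evl d x \<noteq> 0" if "(x, y) \<in> places q" for x y
    using that d by (auto simp: places_def evl_eq_0_iff)
  show ?thesis
  proof (cases "normp q a b = 0")
    case True
    then have "g (x, y) = 0" if "(x, y) \<in> places q" for x y
      using g[OF that] evd[OF that] by (simp add: normp_eq_0_iff)
    then show ?thesis by (intro function_fieldI[of 1 _ _ 0 0]) auto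
  next
    case False
    let ?X = "[:0, 1:] :: 'k poly"
    show ?thesis
    proof (rule function_fieldI[OF False])
      fix x y :: "'k fls" assume xy: "(x, y) \<in> places q"
      have "evl a x + evl b x * y \<noteq> 0"
        using evl_coordinates_eq_0[OF xy] False by (auto simp: normp_eq_0_iff)
      then have g0: "g (x, y) \<noteq> 0" using g[OF xy] by auto
      have "evl (normp q a b) x = x * (evl d x * g (x, y)) * (evl a x + evl b x + evl b x * y)"
        using laurent.ev_normp[of x y q a b] xy g[OF xy] by (simp add: places_def)
      then show "evl (normp q a b) x * inverse (g (x, y)) =
          evl (?X * d * (a + b)) x + evl (?X * d * b) x * y"
        using g0 by (simp add: algebra_simps)
    qed
  qed
qed

section \<open>Separable solutions\<close>

abbreviation xD :: "'a::idom poly \<Rightarrow> 'a poly"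
  where "xD p \<equiv> [:0, 1:] * pderiv p"

lemma coeff_xD: "coeff (xD p) n = of_nat n * coeff p n"
  by (cases n) (simp_all add: coeff_pderiv)

text \<open>\<open>xD\<close> multiplies the coefficient of degree \<open>n\<close> by
  \<open>n\<close> mod 2: it is the projection onto the terms of odd degree.\<close>

lemma xD_xD: "xD (xD p) = xD p" for p :: "'a::{idom,char2} poly"
  by (rule poly_eqI) (simp only: coeff_xD of_nat_char2, simp)

lemma xD_mult: "xD (p * r) = xD p * r + p * xD r" for p r :: "'a::{idom,char2} poly"
  by (simp only: pderiv_mult) (simp add: algebra_simps)

text \<open>Idempotence of \<open>xD\<close> yields \<open>s = xD s + s^2\<close>. Since
  \<open>xD s\<close> has at most the degree of \<open>s\<close>, the square forces \<open>s\<close>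
  to be a constant, which is then idempotent.\<close>

lemma log_derivative_poly:
  fixes u s :: "'a::{idom,char2} poly"
  assumes "xD u = s * u" "u \<noteq> 0"
  shows "s = 0 \<or> s = 1"
proof -
  have "s * u = xD (s * u)" using xD_xD[of u] assms by simp
  also have "\<dots> = (xD s + s\<^sup>2) * u"
    unfolding xD_mult assms by (simp only: power2_eq_square algebra_simps)
  finally have s: "s = xD s + s\<^sup>2" using \<open>u \<noteq> 0\<close> by (metis mult_right_cancel)
  have "degree s = 0"
  proof (rule ccontr)
    assume "degree s \<noteq> 0"
    then have s0: "s \<noteq> 0" by auto
    have "degree (xD s) \<le> degree s"
      by (rule degree_le) (simp only: coeff_xD, simp add: coeff_eq_0)
    then have "degree (xD s) < degree (s\<^sup>2)"
      using \<open>degree s \<noteq> 0\<close> degree_power_eq[OF s0, of 2] by linarith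
    then have "degree (xD s + s\<^sup>2) = degree (s\<^sup>2)" by (rule degree_add_eq_right)
    then show False using s s0 \<open>degree s \<noteq> 0\<close> by (simp add: degree_power_eq)
  qed
  then obtain c where c: "s = [:c:]" by (rule degree_eq_zeroE)
  with s have "c = c\<^sup>2" by (simp add: power2_eq_square)
  then have "c = 0 \<or> c = 1" by (simp add: power2_eq_square)
  then show ?thesis unfolding c by (auto simp: one_pCons)
qed

text \<open>At infinity \<open>v\<close> has the odd order \<open>- (q + 1) e\<close> with
  \<open>e = degree r\<close>. Conjugation fixes the right-hand side, so the trace
  \<open>T = b/d\<close> of \<open>v\<close> satisfies \<open>T^2 + T = 0\<close>. For
  \<open>T = 0\<close>, \<open>v\<close> lies in K(x) and its order would be even; for
  \<open>T = 1\<close>, an odd order can only come from \<open>y\<close>, and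
  \<open>(q + 1) e = 2 q + 1\<close> is impossible for both \<open>e = 1\<close> and
  \<open>e \<ge> 2\<close>.\<close>

lemma no_odd_polynomial_solution:
  fixes r :: "'k::{alg_closed_field,char2} poly"
  assumes q: "even q" "q \<ge> 2" and r: "r \<noteq> 0" "odd (degree r)"
    and v: "v \<in> function_field q"
    and eq: "\<And>x y. (x, y) \<in> places q \<Longrightarrow>
      (v (x, y))\<^sup>2 + v (x, y) = evl r x ^ (q + 1) + inverse (evl r x)"
  shows False
proof -
  obtain a b d where d: "d \<noteq> 0"
    and v: "\<And>x y. (x, y) \<in> places q \<Longrightarrow> evl d x * v (x, y) = evl a x + evl b x * y"
    using v by (rule function_fieldE) blast
  obtain x y :: "'k fls" where xy: "(x, y) \<in> places q" "val x = -2" "val y = - (2 * int q + 1)"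
    using place_at_infinity_exists[OF q(1)] by blast
  let ?e = "int (degree r)"
  have neg: "val x < 0" using xy by simp
  note ev_nz = val_evl_pole(1)[OF neg] and val_ev = val_evl_pole(2)[OF neg]
  have e: "?e \<ge> 1" using r by (cases "degree r") auto
  have vr: "val (evl r x) = - 2 * ?e" by (simp add: val_ev[OF r(1)] xy)
  have v1: "val (evl r x ^ (q + 1)) = - 2 * (int q + 1) * ?e"
    unfolding fls_subdegree_pow vr by (simp add: algebra_simps)
  have lt: "- 2 * (int q + 1) * ?e < 0" using e by (simp add: mult_neg_pos)
  have "val (evl r x ^ (q + 1) + inverse (evl r x)) = - 2 * (int q + 1) * ?e"
    using ev_nz[OF r(1)] v1 lt e vr
    by (subst fls_subdegree_add_eq1) (simp_all del: power_Suc)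
  then have "- 2 * (int q + 1) * ?e = 2 * val (v (x, y))"
    using val_artin_schreier(2)[OF eq[OF xy(1)]] lt by (simp only:)
  then have vv: "val (v (x, y)) = - (int q + 1) * ?e"
    by (simp add: algebra_simps)
  have odd: "odd (- (int q + 1) * ?e)" using q r by simp
  have dx: "evl d x \<noteq> 0" using ev_nz[OF d] .
  have v_eq: "v (x, y) = evl a x / evl d x + evl b x / evl d x * y"
    using v[OF xy(1)] dx by (simp add: field_simps)
  let ?T = "evl b x / evl d x"
  have "v (x, y + 1) = v (x, y) + ?T"
    using v[OF xy(1)] v[OF places_conj[OF xy(1)]] dx by (simp add: field_simps)
  then have "(v (x, y) + ?T)\<^sup>2 + (v (x, y) + ?T) = (v (x, y))\<^sup>2 + v (x, y)"
    using eq[OF xy(1)] eq[OF places_conj[OF xy(1)]] by simp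
  then have "((v (x, y))\<^sup>2 + v (x, y)) + (?T\<^sup>2 + ?T) = (v (x, y))\<^sup>2 + v (x, y)"
    unfolding power2_add by (simp only: add_ac)
  then have "?T\<^sup>2 + ?T = 0" by simp
  then have "?T * ?T = ?T" by (simp only: add_eq_0_iff_eq power2_eq_square)
  then consider "?T = 0" | "?T = 1" by (metis mult_cancel_left1)
  moreover have va: "a = 0 \<or> evl a x / evl d x \<noteq> 0 \<and> even (val (evl a x / evl d x))"
    using ev_nz[of a] val_ev[of a] val_ev[OF d] dx by (cases "a = 0") (simp_all add: divide_inverse xy)
  ultimately show False
  proof cases
    case 1
    then show False using va odd vv v_eq by (cases "a = 0") auto
  next
    case 2
    have y: "y \<noteq> 0" using xy by auto
    have oddy: "odd (val y)" using xy by simp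
    have "val (v (x, y)) = val y"
    proof (cases "a = 0")
      case True
      then show ?thesis using v_eq 2 by simp
    next
      case False
      then have a: "evl a x / evl d x \<noteq> 0" "even (val (evl a x / evl d x))" using va by auto
      then have "val (evl a x / evl d x + y) = min (val (evl a x / evl d x)) (val y)"
        using oddy y by (intro val_add_distinct) auto
      then show ?thesis using v_eq 2 a odd vv by (auto simp: min_def split: if_splits)
    qed
    then have "- (int q + 1) * ?e = - (2 * int q + 1)" unfolding vv xy(3) .
    then have E: "(int q + 1) * ?e = 2 * int q + 1"
      by (simp only: mult_minus_left neg_equal_iff_equal)
    show False
    proof (cases "?e = 1")
      case True
      then show False using E q by simp
    next
      case False
      then have "(int q + 1) * 2 \<le> (int q + 1) * ?e" using e by (intro mult_left_mono) auto
      then show False using E by simp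
    qed
  qed
qed

text \<open>If \<open>diff_a\<close> is nonzero, then \<open>b = 0\<close> and
  \<open>u = a/d\<close>. As \<open>a d = u d^2\<close> and \<open>d^2\<close> has derivative zero,
  \<open>a d\<close> has the same logarithmic derivative as \<open>u\<close>. Holomorphy of du/u
  makes it a polynomial, hence 1 by \<open>log_derivative_poly\<close>; holomorphy of du then gives
  \<open>d dvd a\<close>.\<close>

lemma separable_solution_impossible:
  fixes a b d :: "'k::{alg_closed_field,char2} poly"
  assumes q: "even q" "q \<ge> 2" and d: "d \<noteq> 0"
    and u: "\<And>x y. (x, y) \<in> places q \<Longrightarrow> evl d x * u (x, y) = evl a x + evl b x * y"
    and v: "v \<in> function_field q"
    and nz: "\<And>P. P \<in> places q \<Longrightarrow> u P \<noteq> 0"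
    and eq: "\<And>P. P \<in> places q \<Longrightarrow> (v P)\<^sup>2 + v P = u P ^ (q + 1) + inverse (u P)"
  shows "diff_a q a b d = 0"
proof (rule ccontr)
  assume A0: "diff_a q a b d \<noteq> 0"
  let ?X = "[:0, 1:] :: 'k poly"
  note sol = solution_differentials[OF q d u nz eq]
  have b: "b = 0" using sol(3) A0 by blast
  have A: "diff_a q a b d = ?X * xD (a * d)"
    by (simp only: diff_a_def b power2_eq_square mult.assoc mult_zero_left add_0_right)
  with A0 have a: "a \<noteq> 0" by auto
  have "d * normp q a b = ?X * a * (a * d)"
    by (simp only: normp_def b power2_eq_square mult_zero_left mult_zero_right add_0_right mult_ac)
  moreover have "diff_a q a b d * (a + b) = ?X * a * xD (a * d)"
    unfolding A unfolding b by (simp only: add_0_right mult_ac)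
  ultimately have "?X * a * (a * d) dvd ?X * a * xD (a * d)"
    using sol(4) by (simp only:)
  then have "a * d dvd xD (a * d)"
    using a by (simp only: dvd_mult_cancel_left) simp
  then obtain s where s: "xD (a * d) = s * (a * d)" by (metis dvdE mult.commute)
  moreover have "a * d \<noteq> 0" using a d by simp
  ultimately have "s = 0 \<or> s = 1" by (rule log_derivative_poly)
  moreover have "s \<noteq> 0" using s A A0 by auto
  ultimately have ad: "xD (a * d) = a * d" using s by simp
  have "?X * d * d dvd ?X * d * a"
    using sol(2) unfolding A ad by (simp only: power2_eq_square mult_ac)
  then have "d dvd a" using d by (simp only: dvd_mult_cancel_left) simp
  then obtain r where r: "a = d * r" by (elim dvdE)
  \<comment> \<open>Dividing by \<open>d^2\<close>, a constant for \<open>xD\<close>, leaves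
    \<open>xD r = r\<close>, so \<open>r\<close> has only terms of odd degree.\<close>
  have "pderiv (d\<^sup>2) = 0" by (simp only: power2_eq_square pderiv_mult) (simp add: mult.commute)
  then have "xD (d\<^sup>2) = 0" by simp
  then have "xD (d\<^sup>2 * r) = d\<^sup>2 * xD r" unfolding xD_mult by simp
  moreover have "a * d = d\<^sup>2 * r" unfolding r by (simp only: power2_eq_square mult_ac)
  ultimately have "d\<^sup>2 * xD r = d\<^sup>2 * r" using ad by simp
  then have "xD r = r" using d by (metis mult_left_cancel power_not_zero)
  moreover have "r \<noteq> 0" using r a by auto
  ultimately have "of_nat (degree r) = (1 :: 'k)"
    using coeff_xD[of r "degree r"] by simp
  then have "odd (degree r)" by (auto simp: of_nat_char2 split: if_splits)
  moreover have "u (x, y) = evl r x" if "(x, y) \<in> places q" for x y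
  proof -
    have "evl d x \<noteq> 0" using that d by (simp add: places_def evl_eq_0_iff)
    moreover have "evl d x * u (x, y) = evl d x * evl r x" using u[OF that] b r by simp
    ultimately show ?thesis by simp
  qed
  ultimately show False
    using no_odd_polynomial_solution[OF q \<open>r \<noteq> 0\<close> _ v] eq by simp
qed

section \<open>Inseparable descent\<close>

text \<open>Even and odd powers of \<open>x\<close> are separated and square roots of the
  coefficients taken; in the induction, multiplication by \<open>x\<close> exchanges the two
  parts.\<close>

lemma poly_square_decomposition:
  fixes p :: "'k::{alg_closed_field,char2} poly"
  shows "\<exists>a c. p = a\<^sup>2 + [:0, 1:] * c\<^sup>2"
proof (induction p)
  case 0
  show ?case by (intro exI[of _ 0]) simp
next
  case (pCons r p)
  then obtain a c where p: "p = a\<^sup>2 + [:0, 1:] * c\<^sup>2" by blast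
  obtain s where "poly [:r, 0, 1:] s = 0"
    using alg_closed_imp_poly_has_root[of "[:r, 0, 1:]"] by auto
  then have s: "s\<^sup>2 = r" by (simp add: add_eq_0_iff_eq power2_eq_square)
  have "pCons r p = [:s:]\<^sup>2 + [:0, 1:] * p"
    unfolding s [symmetric] by (simp add: power2_eq_square)
  also have "\<dots> = ([:s:] + [:0, 1:] * c)\<^sup>2 + [:0, 1:] * a\<^sup>2"
    unfolding power2_add p by (simp only: power_mult_distrib power2_eq_square algebra_simps)
  finally show ?case by blast
qed

lemma pderiv_square_decomposition: "pderiv (a\<^sup>2 + [:0, 1:] * c\<^sup>2) = c\<^sup>2"
  for a c :: "'a::{idom,char2} poly"
proof -
  have "pderiv (p\<^sup>2) = 0" for p :: "'a poly"
    by (simp only: power2_eq_square pderiv_mult) (simp add: mult.commute)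
  then show ?thesis by (simp only: pderiv_add pderiv_mult) (simp add: pderiv_pCons)
qed

text \<open>Consider \<open>u d^2 = a d + b d y\<close>. Vanishing of \<open>diff_b\<close> makes
  \<open>b d\<close> a square \<open>\<beta>^2\<close>; vanishing of \<open>diff_a\<close> ties the
  odd part of \<open>a d = \<alpha>^2 + x \<gamma>^2\<close> to it by
  \<open>x \<gamma>^2 = \<beta>^2 (y^2 + y)\<close>. The terms \<open>\<beta>^2 y\<close> cancel and
  \<open>(\<alpha> + \<beta> y)^2\<close> remains.\<close>

lemma inseparable_imp_square:
  fixes a b d :: "'k::{alg_closed_field,char2} poly"
  assumes q: "even q" and d: "d \<noteq> 0"
    and u: "\<And>x y. (x, y) \<in> places q \<Longrightarrow> evl d x * u (x, y) = evl a x + evl b x * y"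
    and diff: "diff_a q a b d = 0" "diff_b b d = 0"
  obtains z where "z \<in> function_field q" "\<And>P. P \<in> places q \<Longrightarrow> u P = (z P)\<^sup>2"
proof -
  let ?X = "[:0, 1:] :: 'k poly"
  obtain \<beta> c where bd: "b * d = \<beta>\<^sup>2 + ?X * c\<^sup>2" using poly_square_decomposition by blast
  with diff(2) have "c = 0"
    by (simp only: diff_b_def pderiv_square_decomposition) simp
  with bd have bd: "b * d = \<beta>\<^sup>2" by simp
  obtain \<alpha> \<gamma> where ad: "a * d = \<alpha>\<^sup>2 + ?X * \<gamma>\<^sup>2" using poly_square_decomposition by blast
  have "?X\<^sup>2 * \<gamma>\<^sup>2 = \<beta>\<^sup>2 * (?X ^ (2 * q + 2) + 1)"
    using diff(1) by (simp only: diff_a_def ad bd pderiv_square_decomposition add_eq_0_iff_eq)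
  define z where "z = (\<lambda>(x, y). (evl \<alpha> x + evl \<beta> x * y) / evl d x)"
  have evd: "evl d x \<noteq> 0" if "(x, y) \<in> places q" for x y
    using that d by (auto simp: places_def evl_eq_0_iff)
  have "z \<in> function_field q"
    by (rule function_fieldI[OF d]) (simp add: z_def evd)
  moreover have "u P = (z P)\<^sup>2" if P: "P \<in> places q" for P
  proof -
    obtain x y where xy: "P = (x, y)" by (cases P)
    with P have x: "x \<noteq> 0" and y: "y\<^sup>2 + y = x ^ (2 * q + 1) + inverse x"
      by (auto simp: places_def acurve_def)
    have W: "x ^ (2 * q + 2) + 1 = x * (y\<^sup>2 + y)"
      using x unfolding y by (simp add: algebra_simps)
    have "x\<^sup>2 * (evl \<gamma> x)\<^sup>2 = (evl \<beta> x)\<^sup>2 * (x ^ (2 * q + 2) + 1)"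
      using arg_cong[OF \<open>?X\<^sup>2 * \<gamma>\<^sup>2 = _\<close>, of "\<lambda>p. evl p x"]
      by (simp del: power_Suc)
    then have "x * (x * (evl \<gamma> x)\<^sup>2) = x * ((evl \<beta> x)\<^sup>2 * (y\<^sup>2 + y))"
      unfolding W by (simp only: power2_eq_square mult_ac)
    then have g: "x * (evl \<gamma> x)\<^sup>2 = (evl \<beta> x)\<^sup>2 * (y\<^sup>2 + y)" using x by simp
    have "(evl d x)\<^sup>2 * u P = evl d x * (evl a x + evl b x * y)"
      using u P xy by (simp add: power2_eq_square mult.assoc)
    also have "\<dots> = evl (a * d) x + evl (b * d) x * y"
      by (simp add: algebra_simps)
    also have "\<dots> = (evl \<alpha> x)\<^sup>2 + (evl \<beta> x)\<^sup>2 * (y\<^sup>2 + y) + (evl \<beta> x)\<^sup>2 * y"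
      unfolding ad bd by (simp add: g)
    also have "\<dots> = (evl \<alpha> x + evl \<beta> x * y)\<^sup>2"
      unfolding power2_add by (simp add: power_mult_distrib distrib_left add.assoc)
    finally have "(evl d x)\<^sup>2 * u P = (evl \<alpha> x + evl \<beta> x * y)\<^sup>2" .
    moreover have "evl d x \<noteq> 0" using evd P xy by blast
    ultimately show ?thesis
      by (simp add: xy z_def power_divide nonzero_eq_divide_eq mult.commute)
  qed
  ultimately show thesis by (rule that)
qed

text \<open>Descent on the order of \<open>u - c\<close> at the fixed place \<open>P0\<close>: it is
  halved on passing to \<open>z\<close> and \<open>s\<close> with \<open>u = z^2\<close> and
  \<open>c = s^2\<close>. The constant is carried along because \<open>u\<close> itself may be a
  unit at \<open>P0\<close>.\<close>

lemma nonconstant_solution_impossible: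
  fixes u v :: "'k::{alg_closed_field,char2} fls \<times> 'k fls \<Rightarrow> 'k fls"
  assumes q: "even q" "q \<ge> 2" and P0: "P0 \<in> places q"
    and "u \<in> function_field q" "v \<in> function_field q"
    and "\<And>P. P \<in> places q \<Longrightarrow> u P \<noteq> 0"
    and "\<And>P. P \<in> places q \<Longrightarrow> (v P)\<^sup>2 + v P = u P ^ (q + 1) + inverse (u P)"
    and "val (u P0 + fls_const c) \<noteq> 0"
  shows False
  using assms(4-)
proof (induction "nat \<bar>val (u P0 + fls_const c)\<bar>" arbitrary: u v c rule: less_induct)
  case less
  note nz = less.prems(3) and eq = less.prems(4)
  obtain a b d where d: "d \<noteq> 0"
    and u: "\<And>x y. (x, y) \<in> places q \<Longrightarrow> evl d x * u (x, y) = evl a x + evl b x * y"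
    using less.prems(1) by (rule function_fieldE) blast
  have "diff_a q a b d = 0"
    by (rule separable_solution_impossible[OF q d u less.prems(2) nz eq])
  moreover have "diff_b b d = 0" by (rule solution_differentials(1)[OF q d u nz eq])
  ultimately obtain z where z: "z \<in> function_field q" "\<And>P. P \<in> places q \<Longrightarrow> u P = (z P)\<^sup>2"
    using inseparable_imp_square[OF q(1) d u] by blast
  obtain s where "poly [:c, 0, 1:] s = 0"
    using alg_closed_imp_poly_has_root[of "[:c, 0, 1:]"] by auto
  then have s: "c = s\<^sup>2" by (simp add: add_eq_0_iff_eq power2_eq_square)
  have "u P0 + fls_const c = (z P0 + fls_const s)\<^sup>2"
    unfolding power2_add z(2)[OF P0] s by (simp add: fls_const_power)
  then have val: "val (u P0 + fls_const c) = 2 * val (z P0 + fls_const s)"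
    by (simp add: fls_subdegree_pow)
  \<comment> \<open>With \<open>r = z^(q+1) + 1/z\<close> the equation for \<open>u = z^2\<close>
    reads \<open>v^2 + v = r^2\<close>. Hence \<open>w = v + r\<close> satisfies
    \<open>w^2 = v\<close>, and so \<open>w^2 + w = r\<close>.\<close>
  define w where "w P = v P + (z P ^ (q + 1) + inverse (z P))" for P
  have w: "w \<in> function_field q"
    unfolding w_def using z(1) less.prems(2)
    by (intro function_field_add function_field_power function_field_inverse)
  have z0: "z P \<noteq> 0" if "P \<in> places q" for P using nz z(2) that by fastforce
  have w_eq: "(w P)\<^sup>2 + w P = z P ^ (q + 1) + inverse (z P)" if P: "P \<in> places q" for P
  proof -
    let ?r = "z P ^ (q + 1) + inverse (z P)"
    have "u P ^ (q + 1) + inverse (u P) = ?r\<^sup>2"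
      unfolding power2_add z(2)[OF P] by (simp add: power_commutes flip: power_mult power_inverse)
        (simp add: power_mult_distrib mult.commute power_mult)
    then have "(v P)\<^sup>2 + v P = ?r\<^sup>2" using eq[OF P] by simp
    then have "(v P)\<^sup>2 = v P + ?r\<^sup>2" by (metis add_self_left add.commute)
    then have "(w P)\<^sup>2 = v P" unfolding w_def power2_add by (simp add: add.assoc)
    then show ?thesis by (simp only: w_def add_self_left)
  qed
  show False
  proof (rule less.hyps[OF _ z(1) w z0 w_eq])
    show "nat \<bar>val (z P0 + fls_const s)\<bar> < nat \<bar>val (u P0 + fls_const c)\<bar>"
      using less.prems(5) unfolding val by linarith
    show "val (z P0 + fls_const s) \<noteq> 0" using less.prems(5) val by simp
  qed
qed

theorem solution_constant:
  fixes u v :: "'k::{alg_closed_field,char2} fls \<times> 'k fls \<Rightarrow> 'k fls"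
  assumes q: "even q" "q \<ge> 2"
    and u: "u \<in> function_field q" and v: "v \<in> function_field q"
    and nz: "\<And>P. P \<in> places q \<Longrightarrow> u P \<noteq> 0"
    and eq: "\<And>P. P \<in> places q \<Longrightarrow> (v P)\<^sup>2 + v P = u P ^ (q + 1) + inverse (u P)"
  shows "\<exists>P\<in>places q. u P \<in> range fls_const"
proof -
  obtain x y :: "'k fls" where P: "(x, y) \<in> places q"
    using place_at_infinity_exists[OF q(1)] by blast
  have val0: "val (u (x, y) + fls_const c) = 0" for c
    using nonconstant_solution_impossible[OF q P u v nz eq] by blast
  \<comment> \<open>The constant coefficient is removed, so \<open>val ?f = 0\<close> can hold only
    for the zero series.\<close>
  let ?f = "u (x, y) + fls_const (fls_nth (u (x, y)) 0)"
  have "fls_nth ?f 0 = 0" by simp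
  then have "?f = 0" using val0[of "fls_nth (u (x, y)) 0"] nth_fls_subdegree_nonzero[of ?f] by auto
  then have "u (x, y) = fls_const (fls_nth (u (x, y)) 0)" by (simp only: add_eq_0_iff_eq)
  then show ?thesis using P by blast
qed

section \<open>Regular functions on the affine curve\<close>

text \<open>The coordinate ring K[x, 1/x, y] of the affine curve.\<close>

definition regular_functions :: "nat \<Rightarrow> ('k::{field,char2} \<times> 'k \<Rightarrow> 'k) set"
  where "regular_functions q =
    curve_functions.fractions (\<lambda>a. a) (range (\<lambda>N. [:0, 1:] ^ N)) (acurve q)"

lemma curve_functions_powers:
  assumes "field_embedding e" "S \<subseteq> acurve q"
  shows "curve_functions e q (range (\<lambda>N. [:0, 1:] ^ N)) S"
proof -
  interpret field_embedding e by fact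
  show ?thesis
  proof
    show "S \<subseteq> acurve q" by fact
    show "1 \<in> range (\<lambda>N. [:0, 1:] ^ N :: 'a poly)" by (rule range_eqI[of _ _ 0]) simp
    show "[:0, 1:] \<in> range (\<lambda>N. [:0, 1:] ^ N :: 'a poly)" by (rule range_eqI[of _ _ 1]) simp
    fix d d' :: "'a poly"
    assume "d \<in> range (\<lambda>N. [:0, 1:] ^ N)" "d' \<in> range (\<lambda>N. [:0, 1:] ^ N)"
    then obtain M N where "d = [:0, 1:] ^ M" "d' = [:0, 1:] ^ N" by blast
    then have "d * d' = [:0, 1:] ^ (M + N)" by (simp only: power_add)
    then show "d * d' \<in> range (\<lambda>N. [:0, 1:] ^ N)" by blast
  qed
qed

interpretation affine: curve_functions "\<lambda>a. a" q "range (\<lambda>N. [:0, 1:] ^ N)" "acurve q"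
  for q :: nat
  by (rule curve_functions_powers) (simp_all add: base.field_embedding_axioms)

lemmas regular_functions_const = affine.fractions_const[folded regular_functions_def]
lemmas regular_functions_fst = affine.fractions_fst[folded regular_functions_def]
lemmas regular_functions_snd = affine.fractions_snd[folded regular_functions_def]
lemmas regular_functions_add = affine.fractions_add[folded regular_functions_def]
lemmas regular_functions_mult = affine.fractions_mult[folded regular_functions_def]
lemmas regular_functions_power = affine.fractions_power[folded regular_functions_def]
lemmas regular_functions_sum = affine.fractions_sum[folded regular_functions_def]
lemmas regular_functions_prod = affine.fractions_prod[folded regular_functions_def]

lemma regular_functionsE:
  assumes "g \<in> regular_functions q"
  obtains N a b where "\<And>x y. (x, y) \<in> acurve q \<Longrightarrow> x ^ N * g (x, y) = poly a x + poly b x * y"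
proof -
  from assms obtain d a b where d: "d \<in> range (\<lambda>N. [:0, 1:] ^ N)"
    and g: "\<And>x y. (x, y) \<in> acurve q \<Longrightarrow> base.ev d x * g (x, y) = base.ev a x + base.ev b x * y"
    unfolding regular_functions_def by (rule affine.fractionsE) blast
  from d obtain N where "d = [:0, 1:] ^ N" by blast
  with g show thesis by (intro that[of N a b]) (simp add: poly_power)
qed

lemma regular_function_zeros:
  assumes "g \<in> regular_functions q"
  shows "(\<forall>c\<in>acurve q. g c = 0) \<or> finite {c \<in> acurve q. g c = 0}"
proof -
  obtain N a b where g: "\<And>x y. (x, y) \<in> acurve q \<Longrightarrow> x ^ N * g (x, y) = poly a x + poly b x * y"
    using assms by (rule regular_functionsE) blast
  show ?thesis
  proof (cases "a = 0 \<and> b = 0")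
    case True
    then have "g (x, y) = 0" if "(x, y) \<in> acurve q" for x y
      using g[OF that] that by (auto simp: acurve_def)
    then show ?thesis by auto
  next
    case False
    have "{c \<in> acurve q. g c = 0} \<subseteq> {(x, y). (x, y) \<in> acurve q \<and> poly a x + poly b x * y = 0}"
      using g by fastforce
    then show ?thesis using finite_zeros_on_acurve[of a b q] False finite_subset by blast
  qed
qed

text \<open>Over a finite field, 1 plus the product of all \<open>x - a\<close> has positive degree
  but no root.\<close>

lemma infinite_alg_closed: "infinite (UNIV :: 'k::alg_closed_field set)"
proof
  assume fin: "finite (UNIV :: 'k set)"
  let ?p = "(\<Prod>a\<in>UNIV. [:- a, 1:]) :: 'k poly"
  have deg: "degree ?p = card (UNIV :: 'k set)"
    by (subst degree_prod_eq_sum_degree) simp_all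
  moreover have "card (UNIV :: 'k set) > 0" using fin by (simp add: card_gt_0_iff)
  ultimately have "degree (?p + 1) > 0" by (subst degree_add_eq_left) simp_all
  then obtain x where "poly (?p + 1) x = 0" using alg_closed_imp_poly_has_root by blast
  moreover have "poly ?p x = 0" unfolding poly_prod by (rule prod_zero[OF fin]) simp
  ultimately show False by simp
qed

lemma infinite_acurve: "infinite (acurve q :: ('k::{alg_closed_field,char2} \<times> 'k) set)"
proof
  assume "finite (acurve q :: ('k \<times> 'k) set)"
  then have "finite (fst ` acurve q :: 'k set)" by simp
  moreover have "UNIV - {0} \<subseteq> (fst ` acurve q :: 'k set)"
  proof
    fix x :: 'k assume "x \<in> UNIV - {0}"
    obtain y where "poly [:x ^ (2 * q + 1) + inverse x, 1, 1:] y = 0"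
      using alg_closed_imp_poly_has_root[of "[:x ^ (2 * q + 1) + inverse x, 1, 1:]"] by auto
    then have "(x ^ (2 * q + 1) + inverse x) + (y\<^sup>2 + y) = 0"
      by (simp add: power2_eq_square algebra_simps)
    then have "y\<^sup>2 + y = x ^ (2 * q + 1) + inverse x" by (metis add_eq_0_iff_eq)
    then have "(x, y) \<in> acurve q" using \<open>x \<in> UNIV - {0}\<close> by (simp add: acurve_def)
    then show "x \<in> fst ` acurve q" by force
  qed
  ultimately show False
    using infinite_alg_closed by (metis finite_Diff2 finite.emptyI finite_insert finite_subset)
qed

lemma acurve_minus_finite: "finite B \<Longrightarrow> \<exists>c\<in>acurve q. c \<notin> B" for B :: "('k::{alg_closed_field,char2} \<times> 'k) set"
  using infinite_acurve finite_subset by (metis subsetI)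

text \<open>The points over \<open>K((t))\<close> comprise both the points over \<open>K\<close> and the places; this is how
  identities that hold at almost all points over \<open>K\<close> are carried over to the places.\<close>

abbreviation laurent_functions :: "nat \<Rightarrow> ('k::{field,char2} fls \<times> 'k fls \<Rightarrow> 'k fls) set"
  where "laurent_functions q \<equiv>
    curve_functions.fractions fls_const (range (\<lambda>N. [:0, 1:] ^ N)) (acurve q)"

interpretation lf: curve_functions fls_const q "range (\<lambda>N. [:0, 1:] ^ N)" "acurve q"
  for q :: nat
  by (rule curve_functions_powers) (simp_all add: laurent.field_embedding_axioms)

definition const_point :: "'k::zero \<times> 'k \<Rightarrow> 'k fls \<times> 'k fls"
  where "const_point = map_prod fls_const fls_const"

lemma fls_const_add: "fls_const (a + b) = fls_const a + fls_const b"
  by (rule fls_plus_const [symmetric])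

lemma fls_const_mult: "fls_const (a * b) = fls_const a * fls_const b" for a b :: "'a::comm_ring_1"
  by simp

lemma fls_const_inverse: "fls_const (inverse a) = inverse (fls_const a)" for a :: "'a::field"
proof (cases "a = 0")
  case False
  have "fls_const a * fls_const (inverse a) = 1"
    using False by (simp flip: fls_const_mult)
  then show ?thesis by (metis inverse_unique)
qed simp

lemma const_point_in_acurve: "c \<in> acurve q \<Longrightarrow> const_point c \<in> acurve q"
  by (cases c) (simp add: acurve_def const_point_def flip: fls_const_power fls_const_add fls_const_mult fls_const_inverse)

lemma evl_const: "evl p (fls_const x) = fls_const (poly p x)"
  by (induction p) (simp_all flip: fls_const_add)

lemma extend_to_laurent:
  fixes g :: "'k::{alg_closed_field,char2} \<times> 'k \<Rightarrow> 'k"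
  assumes "g \<in> regular_functions q"
  obtains G where "G \<in> laurent_functions q"
    "\<And>c. c \<in> acurve q \<Longrightarrow> G (const_point c) = fls_const (g c)"
proof -
  obtain N a b where g: "\<And>x y. (x, y) \<in> acurve q \<Longrightarrow> x ^ N * g (x, y) = poly a x + poly b x * y"
    using assms by (rule regular_functionsE) blast
  define G where "G = (\<lambda>(x, y). (evl a x + evl b x * y) / x ^ N)"
  show thesis
  proof
    show "G \<in> laurent_functions q"
      by (rule lf.fractionsI[of "[:0, 1:] ^ N" _ _ a b]) (auto simp: G_def acurve_def)
    fix c :: "'k \<times> 'k" assume c: "c \<in> acurve q"
    obtain x y where xy: "c = (x, y)" by (cases c)
    with c have "x \<noteq> 0" by (simp add: acurve_def)
    then have "fls_const x ^ N \<noteq> 0" by simp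
    moreover have "fls_const x ^ N * fls_const (g c) = evl a (fls_const x) + evl b (fls_const x) * fls_const y"
      using g[of x y] c xy
      by (simp add: evl_const flip: fls_const_power fls_const_add fls_const_mult)
    ultimately show "G (const_point c) = fls_const (g c)"
      by (simp add: xy const_point_def G_def nonzero_divide_eq_eq mult.commute)
  qed
qed

text \<open>Either hypothesis forces both coordinates \<open>a\<close> and \<open>b\<close> to
  vanish: a nonzero pair has only finitely many zeros over K, and a place acts as a generic point.
  Identities thus pass from almost all constant points to the places, and from one place back to
  every constant point.\<close>

lemma laurent_function_eq_0:
  fixes G :: "'k::{alg_closed_field,char2} fls \<times> 'k fls \<Rightarrow> 'k fls"
  assumes G: "G \<in> laurent_functions q"
    and zero: "(\<exists>B. finite B \<and> (\<forall>c\<in>acurve q. c \<notin> B \<longrightarrow> G (const_point c) = 0)) \<or> (\<exists>P\<in>places q. G P = 0)"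
    and P: "P \<in> acurve q"
  shows "G P = 0"
proof -
  obtain d a b where "d \<in> range (\<lambda>N. [:0, 1:] ^ N)"
    and G: "\<And>x y. (x, y) \<in> acurve q \<Longrightarrow> evl d x * G (x, y) = evl a x + evl b x * y"
    using G by (rule lf.fractionsE) blast
  then obtain N where d: "d = [:0, 1:] ^ N" by blast
  have ab: "a = 0 \<and> b = 0"
    using zero
  proof
    assume "\<exists>P\<in>places q. G P = 0"
    then obtain x y where P: "(x, y) \<in> places q" "G (x, y) = 0" by auto
    then have "evl a x + evl b x * y = 0" using G[of x y] by (simp add: places_def)
    then show ?thesis using evl_coordinates_eq_0[OF P(1)] by blast
  next
    assume "\<exists>B. finite B \<and> (\<forall>c\<in>acurve q. c \<notin> B \<longrightarrow> G (const_point c) = 0)"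
    then obtain B where B: "finite B" "\<And>c. c \<in> acurve q \<Longrightarrow> c \<notin> B \<Longrightarrow> G (const_point c) = 0"
      by blast
    let ?Z = "{(x, y). (x, y) \<in> acurve q \<and> poly a x + poly b x * y = 0}"
    have "(x, y) \<in> ?Z \<union> B" if xy: "(x, y) \<in> acurve q" for x y
    proof (cases "(x, y) \<in> B")
      case False
      then have "evl a (fls_const x) + evl b (fls_const x) * fls_const y = 0"
        using G[of "fls_const x" "fls_const y"] const_point_in_acurve[OF xy] B(2)[OF xy]
        by (simp add: const_point_def)
      then have "fls_const (poly a x + poly b x * y) = 0"
        by (simp add: evl_const fls_const_add fls_const_mult del: fls_const_mult_const)
      then show ?thesis using xy by simp
    qed simp
    then have "acurve q \<subseteq> ?Z \<union> B" by auto
    then have "infinite (?Z \<union> B)" using infinite_acurve finite_subset by blast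
    then show ?thesis using finite_zeros_on_acurve[of a b q] B(1) by blast
  qed
  obtain x y where xy: "P = (x, y)" by (cases P)
  then have "x ^ N * G P = 0" using G[of x y] P ab d by simp
  then show ?thesis using P xy by (auto simp: acurve_def)
qed

lemma laurent_function_in_function_field:
  "G \<in> laurent_functions q \<Longrightarrow> G \<in> function_field q"
proof (erule lf.fractionsE)
  fix d a b :: "'a poly" assume "d \<in> range (\<lambda>N. [:0, 1:] ^ N)"
    and "\<And>x y. (x, y) \<in> acurve q \<Longrightarrow> evl d x * G (x, y) = evl a x + evl b x * y"
  then show ?thesis by (intro function_fieldI[of d _ _ a b]) (auto simp: places_def)
qed

section \<open>Transfer of solutions from the affine curve to the function field\<close>

lemma clear_denominators:
  fixes a b c :: "'a::field"
  assumes "a \<noteq> 0" "b \<noteq> 0" "q \<ge> 1"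
  shows "(c / a)\<^sup>2 + c / a = (b / a) ^ (q + 1) + inverse (b / a) \<longleftrightarrow>
    b * a ^ (q - 1) * (c\<^sup>2 + c * a) = b ^ (q + 2) + a ^ (q + 2)"
proof -
  obtain n where n: "q = Suc n" using assms by (cases q) auto
  have "b * a ^ (q + 1) * ((c / a)\<^sup>2 + c / a) = b * a ^ (q - 1) * (c\<^sup>2 + c * a)"
    using assms by (simp add: n field_simps power2_eq_square)
  moreover have "b * a ^ (q + 1) * ((b / a) ^ (q + 1) + inverse (b / a)) = b ^ (q + 2) + a ^ (q + 2)"
    using assms by (simp add: field_simps)
  moreover have "b * a ^ (q + 1) \<noteq> 0" using assms by simp
  ultimately show ?thesis by (metis mult_left_cancel)
qed

text \<open>The same formulas define \<open>[g0 : g1 : g2]\<close> at the places, where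
  \<open>solution_constant\<close> makes \<open>g1/g0\<close> a constant \<open>r\<close> at one
  place. This carries back to the whole curve and leaves two candidates, \<open>s\<close> and
  \<open>s + 1\<close>, for \<open>g2/g0\<close>.\<close>

theorem affine_solution_constant:
  fixes g0 g1 g2 :: "'k::{alg_closed_field,char2} \<times> 'k \<Rightarrow> 'k"
  assumes q: "even q" "q \<ge> 2"
    and reg: "g0 \<in> regular_functions q" "g1 \<in> regular_functions q" "g2 \<in> regular_functions q"
    and B: "finite B"
    and sol: "\<And>c. c \<in> acurve q \<Longrightarrow> c \<notin> B \<Longrightarrow> g0 c \<noteq> 0 \<and> g1 c \<noteq> 0 \<and>
      (g2 c / g0 c)\<^sup>2 + g2 c / g0 c = (g1 c / g0 c) ^ (q + 1) + inverse (g1 c / g0 c)"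
  shows "\<exists>r s. \<forall>c\<in>acurve q. g1 c = r * g0 c \<and> g2 c = s * g0 c"
proof -
  obtain G0 where G0: "G0 \<in> laurent_functions q" "\<And>c. c \<in> acurve q \<Longrightarrow> G0 (const_point c) = fls_const (g0 c)"
    using reg(1) by (rule extend_to_laurent) blast
  obtain G1 where G1: "G1 \<in> laurent_functions q" "\<And>c. c \<in> acurve q \<Longrightarrow> G1 (const_point c) = fls_const (g1 c)"
    using reg(2) by (rule extend_to_laurent) blast
  obtain G2 where G2: "G2 \<in> laurent_functions q" "\<And>c. c \<in> acurve q \<Longrightarrow> G2 (const_point c) = fls_const (g2 c)"
    using reg(3) by (rule extend_to_laurent) blast
  obtain c0 where c0: "c0 \<in> acurve q" "c0 \<notin> B" using acurve_minus_finite[OF B] by blast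
  have nz: "G0 P \<noteq> 0" "G1 P \<noteq> 0" if "P \<in> places q" for P
  proof -
    have "fls_const (g0 c0) \<noteq> 0" "fls_const (g1 c0) \<noteq> 0" using sol[OF c0] by simp_all
    then have "G0 (const_point c0) \<noteq> 0" "G1 (const_point c0) \<noteq> 0"
      unfolding G0(2)[OF c0(1)] G1(2)[OF c0(1)] .
    then show "G0 P \<noteq> 0" "G1 P \<noteq> 0"
      using laurent_function_eq_0[OF G0(1) _ const_point_in_acurve[OF c0(1)]]
        laurent_function_eq_0[OF G1(1) _ const_point_in_acurve[OF c0(1)]] that by blast+
  qed
  have q1: "q \<ge> 1" using q by simp
  \<comment> \<open>Quotients of the \<open>g\<close>'s may have denominators other than powers of
    \<open>x\<close>; the equation cleared of them is a function to which
    \<open>laurent_function_eq_0\<close> applies.\<close>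
  define E where "E P = G1 P * G0 P ^ (q - 1) * ((G2 P)\<^sup>2 + G2 P * G0 P) + (G1 P ^ (q + 2) + G0 P ^ (q + 2))" for P
  have E: "E \<in> laurent_functions q"
    unfolding E_def
    by (intro lf.fractions_add lf.fractions_mult lf.fractions_power G0 G1 G2)
  have "E (const_point c) = 0" if c: "c \<in> acurve q" "c \<notin> B" for c
  proof -
    have "g1 c * g0 c ^ (q - 1) * ((g2 c)\<^sup>2 + g2 c * g0 c) = g1 c ^ (q + 2) + g0 c ^ (q + 2)"
      using sol[OF c] clear_denominators[OF _ _ q1, of "g0 c" "g1 c" "g2 c"] by blast
    then have "g1 c * g0 c ^ (q - 1) * ((g2 c)\<^sup>2 + g2 c * g0 c) + (g1 c ^ (q + 2) + g0 c ^ (q + 2)) = 0"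
      by (simp only: add_self)
    then have "fls_const (g1 c * g0 c ^ (q - 1) * ((g2 c)\<^sup>2 + g2 c * g0 c) + (g1 c ^ (q + 2) + g0 c ^ (q + 2))) = 0"
      by (simp only: fls_const_0)
    then show ?thesis
      unfolding E_def G0(2)[OF c(1)] G1(2)[OF c(1)] G2(2)[OF c(1)]
      by (simp only: fls_const_power fls_const_add fls_const_mult)
  qed
  then have E0: "E P = 0" if "P \<in> places q" for P
  proof (intro laurent_function_eq_0[OF E])
    show "P \<in> acurve q" using that by (auto simp: places_def)
  qed (use B in blast)
  define u v where "u P = G1 P * inverse (G0 P)" and "v P = G2 P * inverse (G0 P)" for P
  have ff: "u \<in> function_field q" "v \<in> function_field q"
    unfolding u_def v_def
    by (intro function_field_mult function_field_inverse laurent_function_in_function_field G0 G1 G2)+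
  have "\<exists>P\<in>places q. u P \<in> range fls_const"
  proof (rule solution_constant[OF q ff])
    fix P :: "'k fls \<times> 'k fls" assume P: "P \<in> places q"
    show "u P \<noteq> 0" using nz[OF P] by (simp add: u_def)
    have "G1 P * G0 P ^ (q - 1) * ((G2 P)\<^sup>2 + G2 P * G0 P) = G1 P ^ (q + 2) + G0 P ^ (q + 2)"
      using E0[OF P] by (simp only: E_def add_eq_0_iff_eq)
    then show "(v P)\<^sup>2 + v P = u P ^ (q + 1) + inverse (u P)"
      using clear_denominators[OF nz[OF P] q1, of "G2 P"]
      unfolding u_def v_def divide_inverse by blast
  qed
  then obtain P r where P: "P \<in> places q" "u P = fls_const r" by blast
  have "G1 P = u P * G0 P" using nz[OF P(1)] by (simp add: u_def)
  then have "G1 P + fls_const r * G0 P = 0" unfolding P(2) by simp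
  moreover have "(\<lambda>P. G1 P + fls_const r * G0 P) \<in> laurent_functions q"
    by (intro lf.fractions_add lf.fractions_mult lf.fractions_const G0 G1)
  ultimately have "G1 (const_point c) + fls_const r * G0 (const_point c) = 0" if "c \<in> acurve q" for c
    using laurent_function_eq_0 const_point_in_acurve[OF that] P(1) by blast
  then have "fls_const (g1 c + r * g0 c) = 0" if "c \<in> acurve q" for c
    using that G0(2) G1(2) by (simp add: fls_const_add fls_const_mult del: fls_const_mult_const)
  then have g1: "g1 c = r * g0 c" if "c \<in> acurve q" for c
    using that by (simp add: add_eq_0_iff_eq)
  define w where "w = r ^ (q + 1) + inverse r"
  obtain s where "poly [:w, 1, 1:] s = 0"
    using alg_closed_imp_poly_has_root[of "[:w, 1, 1:]"] by auto
  then have "w + (s\<^sup>2 + s) = 0" by (simp add: power2_eq_square algebra_simps)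
  then have s: "s\<^sup>2 + s = w" by (simp only: add_eq_0_iff_eq)
  \<comment> \<open>For \<open>g1/g0 = r\<close> the equation of \<open>v = g2/g0\<close> factors as
    \<open>(v + s) (v + s + 1) = 0\<close>; one factor must vanish on the whole curve.\<close>
  define h h' where "h c = g2 c + s * g0 c" and "h' c = g2 c + (s + 1) * g0 c" for c
  have prod: "h c * h' c = 0" if c: "c \<in> acurve q" "c \<notin> B" for c
  proof -
    have "(g2 c / g0 c)\<^sup>2 + g2 c / g0 c = s\<^sup>2 + s"
      using sol[OF c] g1[OF c(1)] by (simp add: s w_def)
    then have "(g2 c)\<^sup>2 + g2 c * g0 c = (s\<^sup>2 + s) * (g0 c)\<^sup>2"
      using sol[OF c] by (simp add: field_simps power2_eq_square)
    then have "((g2 c)\<^sup>2 + g2 c * g0 c) + (s\<^sup>2 + s) * (g0 c)\<^sup>2 = 0" by simp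
    moreover have "h c * h' c = ((g2 c)\<^sup>2 + g2 c * g0 c) + (s\<^sup>2 + s) * (g0 c)\<^sup>2"
      by (simp add: h_def h'_def power2_eq_square algebra_simps)
    ultimately show ?thesis by simp
  qed
  have hreg: "h \<in> regular_functions q" "h' \<in> regular_functions q"
    unfolding h_def h'_def
    by (intro regular_functions_add regular_functions_mult regular_functions_const reg)+
  have "(\<forall>c\<in>acurve q. h c = 0) \<or> (\<forall>c\<in>acurve q. h' c = 0)"
  proof (rule ccontr)
    assume "\<not> ?thesis"
    then have "finite (B \<union> {c \<in> acurve q. h c = 0} \<union> {c \<in> acurve q. h' c = 0})"
      using regular_function_zeros[OF hreg(1)] regular_function_zeros[OF hreg(2)] B by blast
    from acurve_minus_finite[OF this, of q] obtain c where
      c: "c \<in> acurve q" "c \<notin> B" "h c \<noteq> 0" "h' c \<noteq> 0" by blast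
    then show False using prod[OF c(1,2)] by simp
  qed
  then have "\<exists>s. \<forall>c\<in>acurve q. g2 c = s * g0 c"
    unfolding h_def h'_def add_eq_0_iff_eq by blast
  then show ?thesis using g1 by blast
qed

section \<open>Forms and projective points\<close>

lemma self_in_proj_pt: "v \<in> proj_pt v"
  unfolding proj_pt_def by (rule CollectI, rule exI[of _ 1]) simp

lemma proj_pt_scale:
  assumes c: "c \<noteq> 0"
  shows "proj_pt (\<lambda>i. c * v i) = proj_pt v"
proof (intro equalityI subsetI)
  fix w
  show "w \<in> proj_pt v" if "w \<in> proj_pt (\<lambda>i. c * v i)"
  proof -
    from that obtain a where "a \<noteq> 0" "w = (\<lambda>i. a * (c * v i))" by (auto simp: proj_pt_def)
    then show ?thesis unfolding proj_pt_def using c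
      by (intro CollectI exI[of _ "a * c"]) (simp add: mult.assoc)
  qed
  show "w \<in> proj_pt (\<lambda>i. c * v i)" if "w \<in> proj_pt v"
  proof -
    from that obtain a where "a \<noteq> 0" "w = (\<lambda>i. a * v i)" by (auto simp: proj_pt_def)
    then show ?thesis unfolding proj_pt_def using c
      by (intro CollectI exI[of _ "a / c"]) simp
  qed
qed

lemma proj_pt_eq_iff:
  assumes "v i0 \<noteq> 0" "w j0 \<noteq> 0"
  shows "proj_pt v = proj_pt w \<longleftrightarrow> (\<forall>i j. v i * w j = v j * w i)"
proof
  assume "proj_pt v = proj_pt w"
  then have "v \<in> proj_pt w" using self_in_proj_pt[of v] by simp
  then obtain c where "v = (\<lambda>i. c * w i)" by (auto simp: proj_pt_def)
  then show "\<forall>i j. v i * w j = v j * w i" by simp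
next
  assume eq: "\<forall>i j. v i * w j = v j * w i"
  then have v: "v i = (v j0 / w j0) * w i" for i using assms by (simp add: field_simps)
  then have "v j0 / w j0 \<noteq> 0" using assms by (metis mult_zero_left)
  then show "proj_pt v = proj_pt w" using proj_pt_scale[of "v j0 / w j0" w] v by (metis ext)
qed

lemma mpoly_eval_scale:
  assumes "F \<in> forms R n d"
  shows "mpoly_eval F (\<lambda>i. c * v i) = c ^ d * mpoly_eval F v"
  unfolding mpoly_eval_def sum_distrib_left
proof (rule sum.cong)
  fix m assume "m \<in> Poly_Mapping.keys F"
  then have d: "d = (\<Sum>i\<in>Poly_Mapping.keys m. Poly_Mapping.lookup m i)"
    using assms by (simp add: forms_def)
  show "Poly_Mapping.lookup F m * (\<Prod>i\<in>Poly_Mapping.keys m. (c * v i) ^ Poly_Mapping.lookup m i) =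
      c ^ d * (Poly_Mapping.lookup F m * (\<Prod>i\<in>Poly_Mapping.keys m. v i ^ Poly_Mapping.lookup m i))"
    by (simp add: d power_mult_distrib prod.distrib power_sum mult_ac)
qed simp

lemma vanishes_at_proj_pt:
  assumes "F \<in> forms R n d"
  shows "vanishes_at F (proj_pt v) \<longleftrightarrow> mpoly_eval F v = 0"
proof
  assume "vanishes_at F (proj_pt v)"
  then show "mpoly_eval F v = 0" using self_in_proj_pt by (auto simp: vanishes_at_def)
next
  assume "mpoly_eval F v = 0"
  then show "vanishes_at F (proj_pt v)"
    using mpoly_eval_scale[OF assms] by (auto simp: vanishes_at_def proj_pt_def)
qed

lemma forms_mono: "F \<in> forms R n d \<Longrightarrow> F \<in> forms UNIV n d"
  by (simp add: forms_def)

definition lincomb :: "'a::comm_ring_1 \<Rightarrow> 'a mpoly \<Rightarrow> 'a \<Rightarrow> 'a mpoly \<Rightarrow> 'a mpoly"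
  where "lincomb a F b G = Poly_Mapping.map ((*) a) F + Poly_Mapping.map ((*) b) G"

lemma lookup_lincomb: "Poly_Mapping.lookup (lincomb a F b G) m =
    a * Poly_Mapping.lookup F m + b * Poly_Mapping.lookup G m"
  unfolding lincomb_def lookup_add Poly_Mapping.map.rep_eq when_def by simp

lemma keys_lincomb: "Poly_Mapping.keys (lincomb a F b G) \<subseteq> Poly_Mapping.keys F \<union> Poly_Mapping.keys G"
proof
  fix m assume "m \<in> Poly_Mapping.keys (lincomb a F b G)"
  then have "a * Poly_Mapping.lookup F m + b * Poly_Mapping.lookup G m \<noteq> 0"
    by (simp only: in_keys_iff lookup_lincomb not_False_eq_True)
  then have "Poly_Mapping.lookup F m \<noteq> 0 \<or> Poly_Mapping.lookup G m \<noteq> 0" by force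
  then show "m \<in> Poly_Mapping.keys F \<union> Poly_Mapping.keys G"
    by (simp only: in_keys_iff Un_iff)
qed

lemma mpoly_eval_superset:
  assumes "finite A" "Poly_Mapping.keys F \<subseteq> A"
  shows "mpoly_eval F v = (\<Sum>m\<in>A. Poly_Mapping.lookup F m *
       (\<Prod>i\<in>Poly_Mapping.keys m. v i ^ Poly_Mapping.lookup m i))"
  unfolding mpoly_eval_def
proof (rule sum.mono_neutral_left[OF assms], rule ballI)
  fix m assume "m \<in> A - Poly_Mapping.keys F"
  then have "Poly_Mapping.lookup F m = 0" by (simp only: in_keys_iff DiffE Diff_iff not_not)
  then show "Poly_Mapping.lookup F m * (\<Prod>i\<in>Poly_Mapping.keys m. v i ^ Poly_Mapping.lookup m i) = 0"
    by (simp only: mult_zero_left)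
qed

lemma mpoly_eval_lincomb: "mpoly_eval (lincomb a F b G) v = a * mpoly_eval F v + b * mpoly_eval G v"
proof -
  let ?A = "Poly_Mapping.keys F \<union> Poly_Mapping.keys G"
  have A: "finite ?A" by simp
  show ?thesis
    unfolding mpoly_eval_superset[OF A keys_lincomb[of a F b G]]
      mpoly_eval_superset[OF A Un_upper1] mpoly_eval_superset[OF A Un_upper2]
      lookup_lincomb distrib_right sum.distrib sum_distrib_left mult.assoc ..
qed

lemma lincomb_forms: "F \<in> forms UNIV n d \<Longrightarrow> G \<in> forms UNIV n d \<Longrightarrow> lincomb a F b G \<in> forms UNIV n d"
  using keys_lincomb[of a F b G] by (auto simp: forms_def)

definition mvar :: "nat \<Rightarrow> 'a::comm_ring_1 mpoly"
  where "mvar i = Poly_Mapping.single (Poly_Mapping.single i 1) 1"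

lemma mpoly_eval_mvar: "mpoly_eval (mvar i) v = v i"
  by (simp add: mpoly_eval_def mvar_def)

lemma mvar_forms: "i \<le> n \<Longrightarrow> mvar i \<in> forms UNIV n 1"
  by (auto simp: forms_def mvar_def split: if_splits)

section \<open>Closed and open sets\<close>

lemma zero_locus_subset: "zero_locus n S \<subseteq> proj_space n"
  by (auto simp: zero_locus_def)

lemma zariski_closed_subset: "zariski_closed R n Z \<Longrightarrow> Z \<subseteq> proj_space n"
  using zero_locus_subset by (auto simp: zariski_closed_def)

lemma zariski_closed_UNIV:
  assumes "zariski_closed R n Z"
  shows "zariski_closed UNIV n Z"
proof -
  obtain S where S: "S \<subseteq> (\<Union>d. forms R n d)" "Z = zero_locus n S"
    using assms by (auto simp: zariski_closed_def)
  have "(\<Union>d. forms R n d) \<subseteq> (\<Union>d. forms UNIV n d)"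
    by (rule UN_mono) (auto simp: forms_def)
  with S show ?thesis unfolding zariski_closed_def by (intro exI[of _ S]) simp
qed

lemma zariski_closed_single:
  assumes "F \<in> forms UNIV n d"
  shows "zariski_closed UNIV n (zero_locus n {F})"
  unfolding zariski_closed_def using assms by (intro exI[of _ "{F}"]) auto

lemma zariski_closedE:
  assumes "zariski_closed R n Z" "P \<in> proj_space n" "P \<notin> Z"
  obtains d F where "F \<in> forms R n d" "\<not> vanishes_at F P" "\<And>P'. P' \<in> Z \<Longrightarrow> vanishes_at F P'"
proof -
  obtain S where S: "S \<subseteq> (\<Union>d. forms R n d)" "Z = zero_locus n S"
    using assms by (auto simp: zariski_closed_def)
  with assms obtain F where F: "F \<in> S" "\<not> vanishes_at F P" by (auto simp: zero_locus_def)
  with S obtain d where "F \<in> forms R n d" by auto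
  moreover have "vanishes_at F P'" if "P' \<in> Z" for P'
    using that F S by (simp add: zero_locus_def)
  ultimately show thesis using F that by simp
qed

lemma rel_open_subset: "rel_open R n V U \<Longrightarrow> U \<subseteq> V"
  by (auto simp: rel_open_def)

lemma rel_openE:
  assumes "rel_open R n V U" "P \<in> U" "P \<in> proj_space n"
  obtains d F where "F \<in> forms R n d" "\<not> vanishes_at F P"
    "\<And>P'. P' \<in> V \<Longrightarrow> \<not> vanishes_at F P' \<Longrightarrow> P' \<in> U"
proof -
  obtain Z where Z: "zariski_closed R n Z" "U = V - Z" using assms by (auto simp: rel_open_def)
  have "P \<notin> Z" using Z(2) assms(2) by simp
  from zariski_closedE[OF Z(1) assms(3) this] obtain d F where
    F: "F \<in> forms R n d" "\<not> vanishes_at F P" "\<And>P'. P' \<in> Z \<Longrightarrow> vanishes_at F P'"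
    by blast
  then show thesis using Z(2) by (intro that[of F d]) auto
qed

lemma irreducible_open_dense:
  assumes irr: "abs_irreducible n V" and V: "V \<subseteq> proj_space n"
    and U: "rel_open R n V U" "U \<noteq> {}"
    and F: "F \<in> forms UNIV n d" "P \<in> V" "\<not> vanishes_at F P"
  obtains P' where "P' \<in> U" "\<not> vanishes_at F P'"
proof -
  obtain Z where Z: "zariski_closed R n Z" "U = V - Z" using U by (auto simp: rel_open_def)
  have "\<not> V \<subseteq> zero_locus n {F} \<union> Z"
  proof
    assume "V \<subseteq> zero_locus n {F} \<union> Z"
    moreover have "zariski_closed UNIV n (zero_locus n {F})" "zariski_closed UNIV n Z"
      using zariski_closed_single[OF F(1)] zariski_closed_UNIV[OF Z(1)] .
    ultimately have "V \<subseteq> zero_locus n {F} \<or> V \<subseteq> Z"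
      using irr unfolding abs_irreducible_def by simp
    then show False using F U Z by (auto simp: zero_locus_def)
  qed
  then show thesis using that Z V by (auto simp: zero_locus_def)
qed

lemma proj_spaceE:
  assumes "P \<in> proj_space n"
  obtains v i where "P = proj_pt v" "i \<le> n" "v i \<noteq> 0" "\<And>i. i > n \<Longrightarrow> v i = 0"
proof -
  from assms obtain v i where v: "P = proj_pt v" "v i \<noteq> 0" "\<forall>i>n. v i = 0"
    by (auto simp: proj_space_def)
  then have "i \<le> n" by (meson not_le)
  with v show thesis by (intro that[of v i]) simp_all
qed

lemma zariski_closed_point:
  assumes "P \<in> proj_space n"
  shows "zariski_closed UNIV n {P}"
proof -
  obtain r i0 where r: "P = proj_pt r" "i0 \<le> n" "r i0 \<noteq> 0" "\<And>i. i > n \<Longrightarrow> r i = 0"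
    using assms by (rule proj_spaceE) blast
  define S where "S = {lincomb (r j) (mvar i) (r i) (mvar j) | i j. i \<le> n \<and> j \<le> n}"
  have S: "S \<subseteq> forms UNIV n 1"
    unfolding S_def using lincomb_forms mvar_forms by blast
  have "{P} = zero_locus n S"
  proof (intro equalityI subsetI)
    fix Q assume Q: "Q \<in> {P}"
    have "vanishes_at L P" if L: "L \<in> S" for L
    proof -
      have "mpoly_eval L r = 0"
        using L by (auto simp: S_def mpoly_eval_lincomb mpoly_eval_mvar mult.commute)
      moreover have "L \<in> forms UNIV n 1" using L S by blast
      ultimately show ?thesis unfolding r(1) by (simp add: vanishes_at_proj_pt)
    qed
    then show "Q \<in> zero_locus n S" using Q assms by (simp add: zero_locus_def)
  next
    fix Q assume Q: "Q \<in> zero_locus n S"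
    then obtain v i1 where v: "Q = proj_pt v" "i1 \<le> n" "v i1 \<noteq> 0" "\<And>i. i > n \<Longrightarrow> v i = 0"
      using zero_locus_subset by (metis proj_spaceE subsetD)
    have "v i * r j = v j * r i" for i j
    proof (cases "i \<le> n \<and> j \<le> n")
      case True
      then have "lincomb (r j) (mvar i) (r i) (mvar j) \<in> S" by (auto simp: S_def)
      then have "mpoly_eval (lincomb (r j) (mvar i) (r i) (mvar j)) v = 0"
        using Q S vanishes_at_proj_pt unfolding zero_locus_def v(1) by blast
      then show ?thesis by (simp add: mpoly_eval_lincomb mpoly_eval_mvar add_eq_0_iff_eq mult.commute)
    next
      case False
      then show ?thesis using v(4) r(4) by (auto simp: not_le)
    qed
    then have "proj_pt v = proj_pt r" using proj_pt_eq_iff[of v i1 r i0, OF v(3) r(3)] by blast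
    then show "Q \<in> {P}" using v(1) r(1) by simp
  qed
  then show ?thesis unfolding zariski_closed_def using S by blast
qed

lemma abs_irreducible_point: "abs_irreducible n {P}"
  by (auto simp: abs_irreducible_def)

section \<open>Maps from the affine curve to projective space\<close>

text \<open>Local formulas of a morphism need not glue. Pulled back to the irreducible affine curve,
  however, one of them stays valid outside a finite set \<open>B\<close>. The \<open>g i\<close> are
  regular on the whole curve, but at points of \<open>B\<close> they may have a common zero or fail
  to describe \<open>h\<close>.\<close>

definition represented :: "nat \<Rightarrow> nat \<Rightarrow> point set \<Rightarrow> (F2bar \<times> F2bar \<Rightarrow> point) \<Rightarrow>
    (nat \<Rightarrow> F2bar \<times> F2bar \<Rightarrow> F2bar) \<Rightarrow> (F2bar \<times> F2bar) set \<Rightarrow> bool"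
  where "represented q n V h g B \<longleftrightarrow> (\<forall>i. g i \<in> regular_functions q) \<and> finite B \<and>
    (\<forall>c\<in>acurve q - B. h c \<in> V \<and> (\<exists>i\<le>n. g i c \<noteq> 0) \<and> (\<forall>i>n. g i c = 0) \<and>
      h c = proj_pt (\<lambda>i. g i c))"

lemma representedD:
  assumes "represented q n V h g B"
  shows "g i \<in> regular_functions q" "finite B"
    "c \<in> acurve q \<Longrightarrow> c \<notin> B \<Longrightarrow> h c \<in> V"
    "c \<in> acurve q \<Longrightarrow> c \<notin> B \<Longrightarrow> \<exists>i\<le>n. g i c \<noteq> 0"
    "c \<in> acurve q \<Longrightarrow> c \<notin> B \<Longrightarrow> i > n \<Longrightarrow> g i c = 0"
    "c \<in> acurve q \<Longrightarrow> c \<notin> B \<Longrightarrow> h c = proj_pt (\<lambda>i. g i c)"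
  using assms unfolding represented_def by blast+

lemma represented_in_proj_space:
  assumes "represented q n V h g B" "c \<in> acurve q" "c \<notin> B"
  shows "h c \<in> proj_space n"
  unfolding proj_space_def using representedD(4-6)[OF assms] by blast

lemma represented_mono: "represented q n V h g B \<Longrightarrow> V \<subseteq> V' \<Longrightarrow> represented q n V' h g B"
  unfolding represented_def by blast

lemma regular_mpoly_eval:
  assumes "\<And>i. g i \<in> regular_functions q"
  shows "(\<lambda>c. mpoly_eval F (\<lambda>i. g i c)) \<in> regular_functions q"
  unfolding mpoly_eval_def
  by (intro regular_functions_sum regular_functions_mult regular_functions_const
      regular_functions_prod regular_functions_power assms)

lemma regular_function_zero_everywhere:
  fixes g :: "'k::{alg_closed_field,char2} \<times> 'k \<Rightarrow> 'k"
  assumes "g \<in> regular_functions q" "finite B" "\<And>c. c \<in> acurve q \<Longrightarrow> c \<notin> B \<Longrightarrow> g c = 0" "c \<in> acurve q"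
  shows "g c = 0"
proof (rule ccontr)
  assume "g c \<noteq> 0"
  then have "finite (B \<union> {c \<in> acurve q. g c = 0})"
    using regular_function_zeros[OF assms(1)] assms by blast
  from acurve_minus_finite[OF this, of q] show False using assms(3) by blast
qed

lemma represented_form_zeros:
  assumes rep: "represented q n V h g B" and F: "F \<in> forms R n d"
    and c0: "c0 \<in> acurve q" "c0 \<notin> B" "\<not> vanishes_at F (h c0)"
  shows "finite {c \<in> acurve q - B. vanishes_at F (h c)}"
proof -
  have iff: "vanishes_at F (h c) \<longleftrightarrow> mpoly_eval F (\<lambda>i. g i c) = 0" if "c \<in> acurve q" "c \<notin> B" for c
    unfolding representedD(6)[OF rep that] by (rule vanishes_at_proj_pt[OF F])
  have "finite {c \<in> acurve q. mpoly_eval F (\<lambda>i. g i c) = 0}"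
    using regular_function_zeros[OF regular_mpoly_eval, of g q F] representedD(1)[OF rep] c0 iff by blast
  then show ?thesis by (rule rev_finite_subset) (use iff in blast)
qed

text \<open>A form that is nonzero at \<open>h c0\<close> and vanishes on \<open>V\<close> outside
  \<open>U\<close> pulls back to a nonzero regular function, so only finitely many points join
  \<open>B\<close>. Keeping \<open>c0\<close> outside allows further composition at that
  point.\<close>

lemma represented_open:
  assumes rep: "represented q n V h g B" and U: "rel_open R n V U"
    and c0: "c0 \<in> acurve q" "c0 \<notin> B" "h c0 \<in> U"
  obtains B' where "B \<subseteq> B'" "c0 \<notin> B'" "represented q n U h g B'"
proof -
  obtain d F where F: "F \<in> forms R n d" "\<not> vanishes_at F (h c0)"
    "\<And>P'. P' \<in> V \<Longrightarrow> \<not> vanishes_at F P' \<Longrightarrow> P' \<in> U"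
    using rel_openE[OF U c0(3) represented_in_proj_space[OF rep c0(1,2)]] by blast
  let ?B = "B \<union> {c \<in> acurve q - B. vanishes_at F (h c)}"
  have "represented q n U h g ?B"
    unfolding represented_def
  proof (intro conjI ballI)
    show "finite ?B"
      using representedD(2)[OF rep] represented_form_zeros[OF rep F(1) c0(1,2) F(2)] by simp
    fix c assume "c \<in> acurve q - ?B"
    then have c: "c \<in> acurve q" "c \<notin> B" "\<not> vanishes_at F (h c)" by auto
    show "h c \<in> U" using F(3) representedD(3)[OF rep c(1,2)] c(3) by blast
    show "\<exists>i\<le>n. g i c \<noteq> 0" "\<forall>i>n. g i c = 0" "h c = proj_pt (\<lambda>i. g i c)"
      using representedD(4-6)[OF rep c(1,2)] by blast+
  qed (use representedD(1)[OF rep] in blast)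
  then show thesis using c0 F(2) by (intro that[of ?B]) auto
qed

text \<open>The \<open>g i\<close> are substituted into the forms that describe \<open>f\<close>
  near \<open>h c0\<close>; \<open>represented_open\<close> restricts to the points mapped into that
  neighbourhood.\<close>

lemma represented_morphism:
  assumes rep: "represented q n V h g B" and f: "morphism_over_F2 n V m W f"
    and c0: "c0 \<in> acurve q" "c0 \<notin> B"
  obtains g' B' where "c0 \<notin> B'" "represented q m W (\<lambda>c. f (h c)) g' B'"
proof -
  have "h c0 \<in> V" using representedD(3)[OF rep c0] .
  obtain U d G where UG: "rel_open F2 n V U \<and> h c0 \<in> U \<and> (\<forall>i\<le>m. G i \<in> forms F2 n d) \<and>
      (\<forall>Q\<in>U. \<forall>v\<in>Q. (\<exists>i\<le>m. mpoly_eval (G i) v \<noteq> 0) \<and>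
        f Q = proj_pt (\<lambda>i. if i \<le> m then mpoly_eval (G i) v else 0))"
    using bspec[OF conjunct2[OF f[unfolded morphism_over_F2_def]] \<open>h c0 \<in> V\<close>] by (elim exE)
  then have U: "rel_open F2 n V U" "h c0 \<in> U" by simp_all
  note G = conjunct2[OF conjunct2[OF conjunct2[OF UG]]]
  obtain B' where B': "c0 \<notin> B'" "represented q n U h g B'"
    using represented_open[OF rep U(1) c0 U(2)] by blast
  define g' where "g' i = (if i \<le> m then (\<lambda>c. mpoly_eval (G i) (\<lambda>i. g i c)) else (\<lambda>_. 0))" for i
  have "g' i \<in> regular_functions q" for i
  proof (cases "i \<le> m")
    case True
    have "(\<lambda>c. mpoly_eval (G i) (\<lambda>i. g i c)) \<in> regular_functions q"
      by (rule regular_mpoly_eval) (rule representedD(1)[OF rep])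
    then show ?thesis using True by (simp only: g'_def if_True)
  next
    case False
    then show ?thesis using regular_functions_const[of "0 :: F2bar" q] by (simp only: g'_def if_False)
  qed
  moreover have "f (h c) \<in> W \<and> (\<exists>i\<le>m. g' i c \<noteq> 0) \<and> (\<forall>i>m. g' i c = 0) \<and>
      f (h c) = proj_pt (\<lambda>i. g' i c)" if c: "c \<in> acurve q - B'" for c
  proof -
    have hc: "h c \<in> U" "h c = proj_pt (\<lambda>i. g i c)" using representedD(3,6)[OF B'(2)] c by auto
    then have "(\<lambda>i. g i c) \<in> h c" using self_in_proj_pt by simp
    note Gc = bspec[OF bspec[OF G hc(1)] this]
    have g'_le: "g' i c = mpoly_eval (G i) (\<lambda>i. g i c)" if "i \<le> m" for i
      using that by (simp only: g'_def if_True)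
    have g'_gt: "g' i c = 0" if "\<not> i \<le> m" for i
      using that by (simp only: g'_def if_False)
    have "(\<lambda>i. if i \<le> m then mpoly_eval (G i) (\<lambda>i. g i c) else 0) = (\<lambda>i. g' i c)"
    proof
      show "(if i \<le> m then mpoly_eval (G i) (\<lambda>i. g i c) else 0) = g' i c" for i
        by (cases "i \<le> m") (simp_all only: g'_le g'_gt if_True if_False not_False_eq_True)
    qed
    then have "f (h c) = proj_pt (\<lambda>i. g' i c)" using conjunct2[OF Gc] by (simp only:)
    moreover have "\<exists>i\<le>m. g' i c \<noteq> 0" using conjunct1[OF Gc] g'_le by auto
    moreover have "f (h c) \<in> W"
      using conjunct1[OF f[unfolded morphism_over_F2_def]] hc(1) rel_open_subset[OF U(1)] by blast
    ultimately show ?thesis using g'_gt by (simp only: not_le) blast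
  qed
  ultimately have "represented q m W (\<lambda>c. f (h c)) g' B'"
    using representedD(2)[OF B'(2)] unfolding represented_def by blast
  with B'(1) show thesis by (rule that)
qed

definition affine_point :: "F2bar \<times> F2bar \<Rightarrow> point"
  where "affine_point c = proj_pt (\<lambda>i. if i = 0 then 1 else if i = 1 then fst c else if i = 2 then snd c else 0)"

definition affine_coordinate :: "nat \<Rightarrow> F2bar \<times> F2bar \<Rightarrow> F2bar"
  where "affine_coordinate i = (if i = 0 then (\<lambda>_. 1) else if i = 1 then fst else if i = 2 then snd else (\<lambda>_. 0))"

lemma represented_affine_point:
  "represented q 2 (affine_point ` acurve q) affine_point affine_coordinate {}"
proof -
  have "affine_coordinate i \<in> regular_functions q" for i
    using regular_functions_const[of "0 :: F2bar" q] regular_functions_const[of "1 :: F2bar" q]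
      regular_functions_fst[where 'a = F2bar, of q] regular_functions_snd[where 'a = F2bar, of q]
    by (simp add: affine_coordinate_def)
  moreover have "affine_point c = proj_pt (\<lambda>i. affine_coordinate i c)" for c
    unfolding affine_point_def by (rule arg_cong[of _ _ proj_pt]) (auto simp: affine_coordinate_def)
  moreover have "affine_coordinate 0 c \<noteq> 0" "i > 2 \<Longrightarrow> affine_coordinate i c = 0" for i c
    by (simp_all add: affine_coordinate_def)
  ultimately show ?thesis
    unfolding represented_def by (intro conjI ballI allI impI exI[of _ 0]) simp_all
qed

lemma D_affine_Suc: "D_affine (k + 1) = affine_point ` acurve (2 ^ k)"
proof -
  have "D_affine (k + 1) = {affine_point (x, y) | x y. (x, y) \<in> acurve (2 ^ k)}"
    unfolding D_affine_def acurve_def affine_point_def by (simp cong: if_cong)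
  also have "\<dots> = affine_point ` acurve (2 ^ k)" by auto
  finally show ?thesis .
qed

section \<open>Nonconstant morphisms\<close>

text \<open>If \<open>f P \<noteq> Q\<close>, some 2 by 2 minor \<open>L\<close> of the local
  coordinates of \<open>f\<close> against the coordinates \<open>r\<close> of \<open>Q\<close> is
  nonzero at \<open>P\<close>. By irreducibility it is nonzero somewhere on \<open>U\<close>, hence
  at \<open>h c\<close> for almost all \<open>c\<close>; but \<open>f (h c) = Q\<close> makes every
  minor vanish.\<close>

lemma constant_on_image_imp_constant:
  assumes irr: "abs_irreducible n V" and V: "V \<subseteq> proj_space n"
    and U: "rel_open R n V U" "U \<noteq> {}" and f: "morphism_over_F2 n V m W f"
    and h: "\<And>P. P \<in> U \<Longrightarrow> \<exists>c\<in>acurve q. \<exists>g B. h c = P \<and> c \<notin> B \<and> represented q n V h g B"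
    and B0: "finite B0" and const: "\<And>c. c \<in> acurve q \<Longrightarrow> c \<notin> B0 \<Longrightarrow> f (h c) = Q"
    and P: "P \<in> V"
  shows "f P = Q"
proof -
  have rep_f: "\<exists>c\<in>acurve q. \<exists>g B. h c = P \<and> c \<notin> B \<and> represented q m W (\<lambda>c. f (h c)) g B"
    if "P \<in> U" for P
  proof -
    obtain c g B where c: "c \<in> acurve q" "h c = P" "c \<notin> B" "represented q n V h g B"
      using h[OF \<open>P \<in> U\<close>] by blast
    from represented_morphism[OF c(4) f c(1,3)] obtain g' B' where
      "c \<notin> B'" "represented q m W (\<lambda>c. f (h c)) g' B'" .
    then show ?thesis using c(1,2) by blast
  qed
  obtain P0 where "P0 \<in> U" using U(2) by blast
  from rep_f[OF this] obtain g B where gB: "represented q m W (\<lambda>c. f (h c)) g B"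
    by blast
  obtain c1 where c1: "c1 \<in> acurve q" "c1 \<notin> B" "c1 \<notin> B0"
    using acurve_minus_finite[of "B \<union> B0" q] B0 representedD(2)[OF gB] by auto
  define r where "r i = g i c1" for i
  have Q: "Q = proj_pt r"
    using const[OF c1(1,3)] representedD(6)[OF gB c1(1,2)] unfolding r_def by simp
  obtain j0 where r: "r j0 \<noteq> 0" using representedD(4)[OF gB c1(1,2)] unfolding r_def by blast
  have r0: "r i = 0" if "i > m" for i
    using representedD(5)[OF gB c1(1,2) that] by (simp add: r_def)
  have f_U: "f P = Q" if "P \<in> U" for P
  proof -
    obtain c g B where c: "c \<in> acurve q" "h c = P" "c \<notin> B"
      and rep: "represented q m W (\<lambda>c. f (h c)) g B"
      using rep_f[OF \<open>P \<in> U\<close>] by blast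
    have "g i c * r j + g j c * r i = 0" for i j
    proof (rule regular_function_zero_everywhere[OF _ _ _ c(1)])
      show "(\<lambda>c. g i c * r j + g j c * r i) \<in> regular_functions q"
        by (intro regular_functions_add regular_functions_mult regular_functions_const representedD(1)[OF rep])
      show "finite (B \<union> B0)" using B0 representedD(2)[OF rep] by simp
      fix c assume "c \<in> acurve q" "c \<notin> B \<union> B0"
      then have c: "c \<in> acurve q" "c \<notin> B" "c \<notin> B0" by auto
      obtain i0 where i0: "g i0 c \<noteq> 0" using representedD(4)[OF rep c(1,2)] by blast
      have "proj_pt (\<lambda>i. g i c) = proj_pt r"
        using const[OF c(1,3)] representedD(6)[OF rep c(1,2)] Q by simp
      then have "g i c * r j = g j c * r i"
        using proj_pt_eq_iff[of "\<lambda>i. g i c" i0 r j0, OF i0 r] by blast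
      then show "g i c * r j + g j c * r i = 0" by (simp only: add_self)
    qed
    then have cross: "\<forall>i j. g i c * r j = g j c * r i" by (simp only: add_eq_0_iff_eq) blast
    obtain i0 where i0: "g i0 c \<noteq> 0" using representedD(4)[OF rep c(1,3)] by blast
    have "proj_pt (\<lambda>i. g i c) = proj_pt r"
      using proj_pt_eq_iff[of "\<lambda>i. g i c" i0 r j0, OF i0 r] cross by blast
    then show "f P = Q" using representedD(6)[OF rep c(1,3)] c(2) Q by simp
  qed
  show "f P = Q"
  proof (rule ccontr)
    assume neq: "f P \<noteq> Q"
    obtain N d G where NG: "rel_open F2 n V N \<and> P \<in> N \<and> (\<forall>i\<le>m. G i \<in> forms F2 n d) \<and>
      (\<forall>Q\<in>N. \<forall>v\<in>Q. (\<exists>i\<le>m. mpoly_eval (G i) v \<noteq> 0) \<and>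
        f Q = proj_pt (\<lambda>i. if i \<le> m then mpoly_eval (G i) v else 0))"
      using bspec[OF conjunct2[OF f[unfolded morphism_over_F2_def]] P] by (elim exE)
    then have N: "rel_open F2 n V N" "P \<in> N" and forms: "\<And>i. i \<le> m \<Longrightarrow> G i \<in> forms F2 n d"
      by simp_all
    note G = conjunct2[OF conjunct2[OF conjunct2[OF NG]]]
    define Gm where "Gm v i = (if i \<le> m then mpoly_eval (G i) v else 0)" for v i
    have fG: "f Q = proj_pt (Gm v)" and nzG: "\<exists>i. Gm v i \<noteq> 0" if "Q \<in> N" "v \<in> Q" for Q v
    proof -
      note * = bspec[OF bspec[OF G that(1)] that(2)]
      have "(\<lambda>i. if i \<le> m then mpoly_eval (G i) v else 0) = Gm v"
        by (rule ext) (simp only: Gm_def)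
      then show "f Q = proj_pt (Gm v)" using conjunct2[OF *] by (simp only:)
      show "\<exists>i. Gm v i \<noteq> 0" using conjunct1[OF *] by (auto simp: Gm_def)
    qed
    have Ppr: "P \<in> proj_space n" using P V by blast
    then obtain v where v: "P = proj_pt v" by (rule proj_spaceE)
    then have "v \<in> P" using self_in_proj_pt by simp
    obtain i0 where i0: "Gm v i0 \<noteq> 0" using nzG[OF N(2) \<open>v \<in> P\<close>] by blast
    have "proj_pt (Gm v) \<noteq> proj_pt r" using neq fG[OF N(2) \<open>v \<in> P\<close>] Q by simp
    then obtain i j where ij: "Gm v i * r j \<noteq> Gm v j * r i"
      using proj_pt_eq_iff[of "Gm v" i0 r j0, OF i0 r] by blast
    have le: "i \<le> m" "j \<le> m"
      using ij r0 by (auto simp: Gm_def not_le split: if_splits intro: ccontr)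
    define L where "L = lincomb (r j) (G i) (r i) (G j)"
    have L: "L \<in> forms UNIV n d"
      unfolding L_def using le by (intro lincomb_forms forms_mono[OF forms])
    have L_eval: "mpoly_eval L v = Gm v i * r j + Gm v j * r i" for v
      using le by (simp add: L_def mpoly_eval_lincomb Gm_def mult.commute)
    have LP: "\<not> vanishes_at L P"
      unfolding v vanishes_at_proj_pt[OF L] L_eval using ij by (simp only: add_eq_0_iff_eq not_False_eq_True)
    obtain d' F where F: "F \<in> forms F2 n d'" "\<not> vanishes_at F P"
      "\<And>P'. P' \<in> V \<Longrightarrow> \<not> vanishes_at F P' \<Longrightarrow> P' \<in> N"
      using rel_openE[OF N(1,2) Ppr] by blast
    \<comment> \<open>Used for \<open>L\<close> and for \<open>F\<close>, which marks where the
      local formula for \<open>f\<close> is valid; two cofinite sets of parameters meet.\<close>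
    have cofinite: "\<exists>B. finite B \<and> (\<forall>c\<in>acurve q. c \<notin> B \<longrightarrow> \<not> vanishes_at H (h c) \<and> h c \<in> V)"
      if H: "H \<in> forms UNIV n e" "\<not> vanishes_at H P" for H e
    proof -
      obtain P1 where P1: "P1 \<in> U" "\<not> vanishes_at H P1"
        using irreducible_open_dense[OF irr V U H(1) P H(2)] .
      obtain c g B where c: "c \<in> acurve q" "h c = P1" "c \<notin> B" and rep: "represented q n V h g B"
        using h[OF P1(1)] by blast
      let ?B = "B \<union> {c \<in> acurve q - B. vanishes_at H (h c)}"
      have "finite ?B"
        using represented_form_zeros[OF rep H(1) c(1,3)] c(2) P1(2) representedD(2)[OF rep] by simp
      moreover have "\<forall>c\<in>acurve q. c \<notin> ?B \<longrightarrow> \<not> vanishes_at H (h c) \<and> h c \<in> V"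
        using representedD(3)[OF rep] by blast
      ultimately show ?thesis by blast
    qed
    obtain B1 where B1: "finite B1" "\<forall>c\<in>acurve q. c \<notin> B1 \<longrightarrow> \<not> vanishes_at F (h c) \<and> h c \<in> V"
      using cofinite[OF forms_mono[OF F(1)] F(2)] by blast
    obtain B2 where B2: "finite B2" "\<forall>c\<in>acurve q. c \<notin> B2 \<longrightarrow> \<not> vanishes_at L (h c) \<and> h c \<in> V"
      using cofinite[OF L LP] by blast
    have "finite (B0 \<union> B1 \<union> B2)" using B0 B1 B2 by simp
    from acurve_minus_finite[OF this, of q] obtain c where
      c: "c \<in> acurve q" "c \<notin> B0" "c \<notin> B1" "c \<notin> B2" by blast
    have hV: "h c \<in> V" and Fc: "\<not> vanishes_at F (h c)" and Lc: "\<not> vanishes_at L (h c)"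
      using B1(2) B2(2) c by blast+
    have hN: "h c \<in> N" using F(3)[OF hV Fc] .
    have "h c \<in> proj_space n" using hV V by blast
    then obtain w where w: "h c = proj_pt w" by (rule proj_spaceE)
    then have "w \<in> h c" using self_in_proj_pt by simp
    obtain i1 where i1: "Gm w i1 \<noteq> 0" using nzG[OF hN \<open>w \<in> h c\<close>] by blast
    have "proj_pt (Gm w) = proj_pt r" using fG[OF hN \<open>w \<in> h c\<close>] const[OF c(1,2)] Q by simp
    then have "Gm w i * r j = Gm w j * r i"
      using proj_pt_eq_iff[of "Gm w" i1 r j0, OF i1 r] by blast
    then have "mpoly_eval L w = 0" unfolding L_eval by (simp only: add_self)
    then show False using Lc unfolding w vanishes_at_proj_pt[OF L] by simp
  qed
qed

text \<open>The closure \<open>T\<close> of the image is irreducible because the affine curve is,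
  and it has more than one point. If \<open>T\<close> were smaller than \<open>W\<close>, a point,
  \<open>T\<close> and \<open>W\<close> would form a chain too long for dimension one.\<close>

lemma nonconstant_image_dense:
  assumes W: "zariski_closed R m W" "abs_irreducible m W" "has_dimension m W 1"
    and rep: "represented q m W h g B"
    and nonconst: "c1 \<in> acurve q" "c1 \<notin> B" "c2 \<in> acurve q" "c2 \<notin> B" "h c1 \<noteq> h c2"
    and U: "rel_open R' m W U" "U \<noteq> {}"
  shows "\<exists>c\<in>acurve q. c \<notin> B \<and> h c \<in> U"
proof (rule ccontr)
  assume none: "\<not> ?thesis"
  define S where "S = {F \<in> (\<Union>d. forms UNIV m d). \<forall>c\<in>acurve q. c \<notin> B \<longrightarrow> vanishes_at F (h c)}"
  define T where "T = zero_locus m S"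
  have T_closed: "zariski_closed UNIV m T"
    unfolding zariski_closed_def T_def by (intro exI[of _ S]) (auto simp: S_def)
  have h_T: "h c \<in> T" if "c \<in> acurve q" "c \<notin> B" for c
    using that represented_in_proj_space[OF rep that] unfolding T_def zero_locus_def S_def by simp
  have T_min: "T \<subseteq> Z" if Z: "zariski_closed R'' m Z" "\<And>c. c \<in> acurve q \<Longrightarrow> c \<notin> B \<Longrightarrow> h c \<in> Z" for R'' Z
  proof
    fix P assume P: "P \<in> T"
    show "P \<in> Z"
    proof (rule ccontr)
      assume "P \<notin> Z"
      moreover have "P \<in> proj_space m" using P zero_locus_subset T_def by blast
      ultimately obtain d F where F: "F \<in> forms R'' m d" "\<not> vanishes_at F P"
        "\<And>P'. P' \<in> Z \<Longrightarrow> vanishes_at F P'"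
        using zariski_closedE[OF Z(1)] by blast
      have "F \<in> forms UNIV m d" using forms_mono[OF F(1)] .
      then have "F \<in> S" using F(3) Z(2) unfolding S_def by blast
      then show False using P F(2) unfolding T_def zero_locus_def by simp
    qed
  qed
  have irr: "abs_irreducible m T"
    unfolding abs_irreducible_def
  proof (intro conjI allI impI)
    show "T \<noteq> {}" using h_T nonconst by blast
    fix A A' assume A: "zariski_closed UNIV m A \<and> zariski_closed UNIV m A' \<and> T \<subseteq> A \<union> A'"
    have cofinite: "\<exists>B'. finite B' \<and> (\<forall>c\<in>acurve q. c \<notin> B' \<longrightarrow> h c \<notin> Z)"
      if Z: "zariski_closed UNIV m Z" "\<not> T \<subseteq> Z" for Z
    proof -
      obtain c where c: "c \<in> acurve q" "c \<notin> B" "h c \<notin> Z" using T_min[OF Z(1)] Z(2) by blast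
      obtain d F where F: "F \<in> forms UNIV m d" "\<not> vanishes_at F (h c)"
        "\<And>P'. P' \<in> Z \<Longrightarrow> vanishes_at F P'"
        using zariski_closedE[OF Z(1) represented_in_proj_space[OF rep c(1,2)] c(3)] by blast
      let ?B = "B \<union> {c \<in> acurve q - B. vanishes_at F (h c)}"
      have "finite ?B"
        using represented_form_zeros[OF rep F(1) c(1,2) F(2)] representedD(2)[OF rep] by simp
      moreover have "\<forall>c\<in>acurve q. c \<notin> ?B \<longrightarrow> h c \<notin> Z" using F(3) by blast
      ultimately show ?thesis by blast
    qed
    show "T \<subseteq> A \<or> T \<subseteq> A'"
    proof (rule ccontr)
      assume "\<not> (T \<subseteq> A \<or> T \<subseteq> A')"
      then have "\<not> T \<subseteq> A" "\<not> T \<subseteq> A'" by simp_all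
      then obtain B1 B2 where B12: "finite B1" "\<forall>c\<in>acurve q. c \<notin> B1 \<longrightarrow> h c \<notin> A"
        "finite B2" "\<forall>c\<in>acurve q. c \<notin> B2 \<longrightarrow> h c \<notin> A'"
        using cofinite[OF conjunct1[OF A]] cofinite[OF conjunct1[OF conjunct2[OF A]]] by auto
      have "finite (B \<union> B1 \<union> B2)" using B12 representedD(2)[OF rep] by simp
      from acurve_minus_finite[OF this, of q] obtain c where
        "c \<in> acurve q" "c \<notin> B" "c \<notin> B1" "c \<notin> B2" by blast
      then show False using h_T[of c] B12 A by blast
    qed
  qed
  have T_W: "T \<subseteq> W" by (rule T_min[OF W(1)]) (rule representedD(3)[OF rep])
  have "T = W"
  proof (rule ccontr)
    assume "T \<noteq> W"
    let ?P = "h c1"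
    define Z where "Z i = (if i = 0 then {?P} else if i = 1 then T else W)" for i :: nat
    have "zariski_closed UNIV m {?P}"
      by (rule zariski_closed_point[OF represented_in_proj_space[OF rep nonconst(1,2)]])
    moreover have "?P \<in> W" using T_W h_T[OF nonconst(1,2)] by blast
    ultimately have "zariski_closed UNIV m (Z i) \<and> abs_irreducible m (Z i) \<and> Z i \<subseteq> W" for i
      using abs_irreducible_point[of m ?P] irr W(2) T_closed zariski_closed_UNIV[OF W(1)] T_W
      by (simp add: Z_def)
    moreover have "Z i \<subset> Z (Suc i)" if "i < 2" for i
    proof -
      from that consider "i = 0" | "i = 1" by linarith
      then show ?thesis
      proof cases
        case 1
        have "{?P} \<subset> T" using h_T nonconst by blast
        then show ?thesis using 1 by (simp add: Z_def)
      next
        case 2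
        have "T \<subset> W" using T_W \<open>T \<noteq> W\<close> by blast
        then show ?thesis using 2 by (simp add: Z_def)
      qed
    qed
    ultimately have "irreducible_chain m W (Suc 1) Z"
      by (simp add: irreducible_chain_def)
    then show False using W(3) by (auto simp: has_dimension_def)
  qed
  obtain Z where Z: "zariski_closed R' m Z" "U = W - Z" using U(1) by (auto simp: rel_open_def)
  have "T \<subseteq> Z"
    by (rule T_min[OF Z(1)]) (use none Z(2) representedD(3)[OF rep] in blast)
  then show False using \<open>T = W\<close> Z(2) U(2) by blast
qed

text \<open>The target lies in the chart where coordinate 0 is nonzero, so \<open>g 1 / g 0\<close>
  and \<open>g 2 / g 0\<close> are affine coordinates there and solve the equation treated in
  \<open>affine_solution_constant\<close>.\<close>

lemma map_to_D_affine_constant: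
  assumes k: "k \<ge> 1" and rep: "represented (2 ^ k) 2 (D_affine k) h g B"
  shows "\<exists>Q. \<forall>c\<in>acurve (2 ^ k). c \<notin> B \<longrightarrow> h c = Q"
proof -
  let ?q = "2 ^ k :: nat"
  have q: "even ?q" "?q \<ge> 2"
    using k by (simp, metis power_increasing power_one_right one_le_numeral)
  have sol: "g 0 c \<noteq> 0 \<and> g 1 c \<noteq> 0 \<and>
      (g 2 c / g 0 c)\<^sup>2 + g 2 c / g 0 c = (g 1 c / g 0 c) ^ (?q + 1) + inverse (g 1 c / g 0 c)"
    if c: "c \<in> acurve ?q" "c \<notin> B" for c
  proof -
    have "h c \<in> D_affine k" by (rule representedD(3)[OF rep c])
    then obtain x y where xy: "h c = affine_point (x, y)" "x \<noteq> 0" "y\<^sup>2 + y = x ^ (?q + 1) + inverse x"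
      unfolding D_affine_def affine_point_def by (auto cong: if_cong)
    have "(\<lambda>i. g i c) \<in> h c"
      using representedD(6)[OF rep c] self_in_proj_pt by simp
    then obtain t where t: "t \<noteq> 0"
      "\<And>i. g i c = t * (if i = 0 then 1 else if i = 1 then x else if i = 2 then y else 0)"
      unfolding xy(1) affine_point_def proj_pt_def by (auto simp: fun_eq_iff)
    have "g 0 c = t" "g 1 c = t * x" "g 2 c = t * y" using t(2)[of 0] t(2)[of 1] t(2)[of 2] by simp_all
    then have "g 0 c \<noteq> 0" "g 1 c \<noteq> 0" "g 1 c / g 0 c = x" "g 2 c / g 0 c = y"
      using t(1) xy(2) by simp_all
    then show ?thesis using xy(3) by simp
  qed
  obtain r s where rs: "\<forall>c\<in>acurve ?q. g 1 c = r * g 0 c \<and> g 2 c = s * g 0 c"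
    using affine_solution_constant[OF q representedD(1)[OF rep] representedD(1)[OF rep]
        representedD(1)[OF rep] representedD(2)[OF rep] sol] by blast
  have "h c = affine_point (r, s)" if c: "c \<in> acurve ?q" "c \<notin> B" for c
  proof -
    have "(\<lambda>i. g i c) = (\<lambda>i. g 0 c * (if i = 0 then 1 else if i = 1 then fst (r, s) else if i = 2 then snd (r, s) else 0))"
    proof
      fix i :: nat
      consider "i = 0" | "i = 1" | "i = 2" | "i > 2" by linarith
      then show "g i c = g 0 c * (if i = 0 then 1 else if i = 1 then fst (r, s) else if i = 2 then snd (r, s) else 0)"
        using rs c(1) representedD(5)[OF rep c, of i] by cases (simp_all add: mult.commute)
    qed
    then show ?thesis
      using representedD(6)[OF rep c] proj_pt_scale[OF conjunct1[OF sol[OF c]]]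
      by (simp only: affine_point_def)
  qed
  then show ?thesis by blast
qed

theorem theorem15:
  fixes k m n :: nat and V W :: "point set"
  assumes "k \<ge> 1"
    and "is_D_curve (k + 1) n V"
    and "is_D_curve k m W"
  shows "\<not> (\<exists>f. morphism_over_F2 n V m W f \<and> nonconstant_on V f)"
proof
  assume "\<exists>f. morphism_over_F2 n V m W f \<and> nonconstant_on V f"
  then obtain f where f: "morphism_over_F2 n V m W f" and nonconst: "nonconstant_on V f" by blast
  let ?q = "2 ^ k :: nat"
  have V: "zariski_closed F2 n V" "abs_irreducible n V"
    and biV: "birational_over_F2 2 (affine_point ` acurve ?q) n V"
    using assms(2) unfolding is_D_curve_def smooth_projective_curve_def D_affine_Suc by simp_all
  obtain U1 U1' \<phi>1 \<psi>1 where V': "U1 \<noteq> {} \<and> U1' \<noteq> {} \<and>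
      rel_open F2 2 (affine_point ` acurve ?q) U1 \<and> rel_open F2 n V U1' \<and>
      morphism_over_F2 2 U1 n U1' \<phi>1 \<and> morphism_over_F2 n U1' 2 U1 \<psi>1 \<and>
      (\<forall>P\<in>U1. \<psi>1 (\<phi>1 P) = P) \<and> (\<forall>P\<in>U1'. \<phi>1 (\<psi>1 P) = P)"
    using biV unfolding birational_over_F2_def by (elim exE)
  have U1: "U1' \<noteq> {}" "rel_open F2 2 (affine_point ` acurve ?q) U1" "rel_open F2 n V U1'"
    and \<phi>1: "morphism_over_F2 2 U1 n U1' \<phi>1" and \<psi>1: "morphism_over_F2 n U1' 2 U1 \<psi>1"
    and inv1: "\<forall>P\<in>U1'. \<phi>1 (\<psi>1 P) = P"
    using V' by - (elim conjE, assumption)+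
  have W: "zariski_closed F2 m W" "abs_irreducible m W" "has_dimension m W 1"
    and biW: "birational_over_F2 2 (D_affine k) m W"
    using assms(3) unfolding is_D_curve_def smooth_projective_curve_def by simp_all
  obtain U2 U2' \<phi>2 \<psi>2 where W': "U2 \<noteq> {} \<and> U2' \<noteq> {} \<and>
      rel_open F2 2 (D_affine k) U2 \<and> rel_open F2 m W U2' \<and>
      morphism_over_F2 2 U2 m U2' \<phi>2 \<and> morphism_over_F2 m U2' 2 U2 \<psi>2 \<and>
      (\<forall>P\<in>U2. \<psi>2 (\<phi>2 P) = P) \<and> (\<forall>P\<in>U2'. \<phi>2 (\<psi>2 P) = P)"
    using biW unfolding birational_over_F2_def by (elim exE)
  have U2: "U2' \<noteq> {}" "rel_open F2 2 (D_affine k) U2" "rel_open F2 m W U2'"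
    and \<psi>2: "morphism_over_F2 m U2' 2 U2 \<psi>2" and inv2: "\<forall>P\<in>U2'. \<phi>2 (\<psi>2 P) = P"
    using W' by - (elim conjE, assumption)+
  have Vp: "V \<subseteq> proj_space n" by (rule zariski_closed_subset[OF V(1)])
  \<comment> \<open>A parametrisation of an open part of \<open>V\<close> by the affine source
    curve.\<close>
  define h where "h = (\<lambda>c. \<phi>1 (affine_point c))"
  have h: "\<exists>c\<in>acurve ?q. \<exists>g B. h c = P \<and> c \<notin> B \<and> represented ?q n V h g B" if P: "P \<in> U1'" for P
  proof -
    have "\<psi>1 P \<in> U1" using conjunct1[OF \<psi>1[unfolded morphism_over_F2_def]] P by blast
    then obtain c where c: "c \<in> acurve ?q" "affine_point c = \<psi>1 P" "affine_point c \<in> U1"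
      using rel_open_subset[OF U1(2)] by force
    obtain B where B: "c \<notin> B" "represented ?q 2 U1 affine_point affine_coordinate B"
      by (rule represented_open[OF represented_affine_point U1(2) c(1) _ c(3)]) simp
    obtain g B' where gB: "c \<notin> B'" "represented ?q n U1' (\<lambda>c. \<phi>1 (affine_point c)) g B'"
      by (rule represented_morphism[OF B(2) \<phi>1 c(1) B(1)])
    have "h c = P" unfolding h_def c(2) using bspec[OF inv1 P] .
    moreover have "represented ?q n V h g B'"
      unfolding h_def by (rule represented_mono[OF gB(2) rel_open_subset[OF U1(3)]])
    ultimately show ?thesis using c(1) gB(1) by blast
  qed
  have not_const: "\<not> (\<forall>c\<in>acurve ?q. c \<notin> B \<longrightarrow> f (h c) = Q)" if "finite B" for B Q
  proof
    assume const: "\<forall>c\<in>acurve ?q. c \<notin> B \<longrightarrow> f (h c) = Q"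
    have "f P = Q" if "P \<in> V" for P
      by (rule constant_on_image_imp_constant[OF V(2) Vp U1(3,1) f h \<open>finite B\<close> const[rule_format] that])
    then show False using nonconst unfolding nonconstant_on_def by blast
  qed
  obtain P0 where "P0 \<in> U1'" using U1(1) by blast
  then obtain c0 g0 B0 where c0: "c0 \<in> acurve ?q" "c0 \<notin> B0" "represented ?q n V h g0 B0"
    using h by blast
  obtain g1 B1 where rep1: "represented ?q m W (\<lambda>c. f (h c)) g1 B1"
    by (rule represented_morphism[OF c0(3) f c0(1,2)])
  note fin1 = representedD(2)[OF rep1]
  obtain c1 where c1: "c1 \<in> acurve ?q" "c1 \<notin> B1" using not_const[OF fin1] by blast
  obtain c2 where c2: "c2 \<in> acurve ?q" "c2 \<notin> B1" "f (h c2) \<noteq> f (h c1)" using not_const[OF fin1] by blast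
  \<comment> \<open>Dominance enters here: the image has to meet \<open>U2'\<close>, the open set
    from which \<psi>2 leads back to the affine target.\<close>
  obtain c where c: "c \<in> acurve ?q" "c \<notin> B1" "f (h c) \<in> U2'"
    using nonconstant_image_dense[OF W rep1 c2(1,2) c1 c2(3) U2(3,1)] by blast
  obtain B2 where B2: "c \<notin> B2" "represented ?q m U2' (\<lambda>c. f (h c)) g1 B2"
    by (rule represented_open[OF rep1 U2(3) c])
  obtain g3 B3 where rep2: "represented ?q 2 U2 (\<lambda>c. \<psi>2 (f (h c))) g3 B3"
    by (rule represented_morphism[OF B2(2) \<psi>2 c(1) B2(1)])
  note rep3 = represented_mono[OF rep2 rel_open_subset[OF U2(2)]]
  obtain Q where Q: "\<forall>c\<in>acurve ?q. c \<notin> B3 \<longrightarrow> \<psi>2 (f (h c)) = Q"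
    using map_to_D_affine_constant[OF assms(1) rep3] by blast
  \<comment> \<open>Applying \<phi>2 undoes \<psi>2, so constancy in the affine target makes
    \<open>f\<close> constant at almost all parameters, against \<open>not_const\<close>.\<close>
  have "f (h c) = \<phi>2 Q" if c: "c \<in> acurve ?q" "c \<notin> B2 \<union> B3" for c
  proof -
    have "f (h c) \<in> U2'" using representedD(3)[OF B2(2) c(1)] c(2) by simp
    from bspec[OF inv2 this] have "\<phi>2 (\<psi>2 (f (h c))) = f (h c)" .
    moreover have "\<psi>2 (f (h c)) = Q" using bspec[OF Q c(1)] c(2) by simp
    ultimately show ?thesis by simp
  qed
  then have "\<forall>c\<in>acurve ?q. c \<notin> B2 \<union> B3 \<longrightarrow> f (h c) = \<phi>2 Q" by simp
  moreover have "finite (B2 \<union> B3)" using representedD(2)[OF B2(2)] representedD(2)[OF rep3] by simp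
  note not_const[OF this, of "\<phi>2 Q"]
  ultimately show False by (rule notE[rotated])
qed

end
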